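(* Let $\mathcal{L}$ be an operator on $\mathbb{R}^n$ satisfying the standing assumptions listed in the context. Let $1\le p<\infty$ and let $u\in C^2(\mathbb{R}^n,\mathbb{R})\cap L^{p+1}(\mathbb{R}^n)$ be a classical solution to $\mathcal{L}u=|u|^{p-1}u$ in $\mathbb{R}^n$. Then $u\equiv 0$.
   Context: Standing assumptions. $\mathcal{L}:=\mathrm{div}(A\nabla)+\langle b,\nabla\rangle$ is a linear second order partial differential operator on $\mathbb{R}^n$, where $A=(a_{ij})_{i,j=1,\dots,n}$ is a symmetric $n\times n$ matrix with entries $a_{ij}\in C^\infty(\mathbb{R}^n,\mathbb{R})$, $b=(b_1,\dots,b_n)$ has components $b_j\in C^\infty(\mathbb{R}^n,\mathbb{R})$, and $\mathrm{div}$, $\nabla$, $\langle\cdot,\cdot\rangle$ are the Euclidean divergence, gradient and inner product. It is assumed that $\langle A(x)\xi,\xi\rangle\ge 0$ for all $x,\xi\in\mathbb{R}^n$ and $\mathrm{trace}\,A(0)>0$. Moreover: (1) $\mathcal{L}$ is hypoelliptic: if $w$ is a distribution on an open set $\Omega\subseteq\mathbb{R}^n$ and $\mathcal{L}w$ is smooth in $\Omega$, then $w$ is smooth in $\Omega$. (2) There is a Lie group $\mathbb{G}=(\mathbb{R}^n,\circ)$ such that $\mathcal{L}$ is left translation invariant on $\mathbb{G}$, i.e. $\mathcal{L}(w(\alpha\circ\cdot))(x)=(\mathcal{L}w)(\alpha\circ x)$ for all $\alpha,x\in\mathbb{R}^n$ and all $w\in C^\infty(\mathbb{R}^n,\mathbb{R})$.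 (3) The Lebesgue measure on $\mathbb{R}^n$ is both left and right invariant on $\mathbb{G}$. $L^{p+1}$ is taken with respect to Lebesgue measure. *)

theory Defs
  imports "HOL-Analysis.Analysis" "HOL-Algebra.Group"
begin

section \<open>Functions of class \<open>C\<^sup>k\<close>\<close>

definition partial_deriv ::
    "'a::euclidean_space \<Rightarrow> ('a \<Rightarrow> 'b::real_normed_vector) \<Rightarrow> 'a \<Rightarrow> 'b" where
  "partial_deriv i f x = frechet_derivative f (at x) i"

text \<open>The sets \<open>S\<close> below are open in all uses, so derivatives are taken \<open>at x\<close> and not
  relative to \<open>S\<close>.\<close>

primrec Ck_on ::
    "nat \<Rightarrow> ('a::euclidean_space \<Rightarrow> 'b::real_normed_vector) \<Rightarrow> 'a set \<Rightarrow> bool" where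
  "Ck_on 0 f S \<longleftrightarrow> continuous_on S f"
| "Ck_on (Suc k) f S \<longleftrightarrow>
     (\<forall>x\<in>S. f differentiable (at x)) \<and> (\<forall>i\<in>Basis. Ck_on k (partial_deriv i f) S)"

definition smooth_on ::
    "('a::euclidean_space \<Rightarrow> 'b::real_normed_vector) \<Rightarrow> 'a set \<Rightarrow> bool" where
  "smooth_on f S \<longleftrightarrow> (\<forall>k. Ck_on k f S)"

section \<open>The differential operator\<close>

definition gradient :: "(real ^ 'n \<Rightarrow> real) \<Rightarrow> real ^ 'n \<Rightarrow> real ^ 'n" where
  "gradient f x = (\<chi> i. partial_deriv (axis i 1) f x)"

definition divergence :: "(real ^ 'n \<Rightarrow> real ^ 'n) \<Rightarrow> real ^ 'n \<Rightarrow> real" where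
  "divergence F x = (\<Sum>i\<in>UNIV. partial_deriv (axis i 1) (\<lambda>y. F y $ i) x)"

definition diff_op ::
    "(real ^ 'n \<Rightarrow> real ^ 'n ^ 'n) \<Rightarrow> (real ^ 'n \<Rightarrow> real ^ 'n) \<Rightarrow>
     (real ^ 'n \<Rightarrow> real) \<Rightarrow> real ^ 'n \<Rightarrow> real" where
  "diff_op A b u x = divergence (\<lambda>y. A y *v gradient u y) x + b x \<bullet> gradient u x"

section \<open>Distributions and hypoellipticity\<close>

definition test_functions :: "(real ^ 'n) set \<Rightarrow> (real ^ 'n \<Rightarrow> real) set" where
  "test_functions \<Omega> =
     {\<phi>. smooth_on \<phi> UNIV \<and> compact (closure (support_on UNIV \<phi>)) \<and>
         closure (support_on UNIV \<phi>) \<subseteq> \<Omega>}"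

definition iter_partial_deriv ::
    "'a::euclidean_space list \<Rightarrow> ('a \<Rightarrow> 'b::real_normed_vector) \<Rightarrow> 'a \<Rightarrow> 'b" where
  "iter_partial_deriv vs f = foldr partial_deriv vs f"

text \<open>Lists of basis vectors play the role of multi-indices.\<close>

definition test_seminorm :: "nat \<Rightarrow> (real ^ 'n \<Rightarrow> real) \<Rightarrow> real" where
  "test_seminorm N \<phi> =
     (\<Sum>vs\<in>{vs. set vs \<subseteq> Basis \<and> length vs \<le> N}. SUP x. \<bar>iter_partial_deriv vs \<phi> x\<bar>)"

text \<open>A distribution on \<open>\<Omega>\<close> is represented by a total function on all real functions; only
  its values on test functions on \<open>\<Omega>\<close> are meaningful.\<close>

definition distribution_on ::
    "(real ^ 'n) set \<Rightarrow> ((real ^ 'n \<Rightarrow> real) \<Rightarrow> real) \<Rightarrow> bool" where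
  "distribution_on \<Omega> w \<longleftrightarrow>
     (\<forall>\<phi>\<in>test_functions \<Omega>. \<forall>\<psi>\<in>test_functions \<Omega>. w (\<lambda>x. \<phi> x + \<psi> x) = w \<phi> + w \<psi>) \<and>
     (\<forall>\<phi>\<in>test_functions \<Omega>. \<forall>c. w (\<lambda>x. c * \<phi> x) = c * w \<phi>) \<and>
     (\<forall>K. compact K \<and> K \<subseteq> \<Omega> \<longrightarrow>
        (\<exists>C N. \<forall>\<phi>\<in>test_functions \<Omega>.
           closure (support_on UNIV \<phi>) \<subseteq> K \<longrightarrow> \<bar>w \<phi>\<bar> \<le> C * test_seminorm N \<phi>))"

definition smooth_distribution_on ::
    "(real ^ 'n) set \<Rightarrow> ((real ^ 'n \<Rightarrow> real) \<Rightarrow> real) \<Rightarrow> bool" where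
  "smooth_distribution_on \<Omega> w \<longleftrightarrow>
     (\<exists>f. smooth_on f \<Omega> \<and>
        (\<forall>\<phi>\<in>test_functions \<Omega>. w \<phi> = integral\<^sup>L lebesgue (\<lambda>x. f x * \<phi> x)))"

definition distr_partial ::
    "real ^ 'n \<Rightarrow> ((real ^ 'n \<Rightarrow> real) \<Rightarrow> real) \<Rightarrow> (real ^ 'n \<Rightarrow> real) \<Rightarrow> real" where
  "distr_partial i w \<phi> = - w (partial_deriv i \<phi>)"

definition distr_mult ::
    "(real ^ 'n \<Rightarrow> real) \<Rightarrow> ((real ^ 'n \<Rightarrow> real) \<Rightarrow> real) \<Rightarrow> (real ^ 'n \<Rightarrow> real) \<Rightarrow> real" where
  "distr_mult a w \<phi> = w (\<lambda>x. a x * \<phi> x)"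

text \<open>\<open>\<Sum>\<^sub>i \<partial>\<^sub>i (\<Sum>\<^sub>j a\<^sub>i\<^sub>j \<partial>\<^sub>j w) + \<Sum>\<^sub>j b\<^sub>j \<partial>\<^sub>j w\<close> in the sense of distributions.\<close>

definition distr_diff_op ::
    "(real ^ 'n \<Rightarrow> real ^ 'n ^ 'n) \<Rightarrow> (real ^ 'n \<Rightarrow> real ^ 'n) \<Rightarrow>
     ((real ^ 'n \<Rightarrow> real) \<Rightarrow> real) \<Rightarrow> (real ^ 'n \<Rightarrow> real) \<Rightarrow> real" where
  "distr_diff_op A b w \<phi> =
     (\<Sum>i\<in>UNIV. distr_partial (axis i 1)
        (\<lambda>\<psi>. \<Sum>j\<in>UNIV. distr_mult (\<lambda>x. A x $ i $ j) (distr_partial (axis j 1) w) \<psi>) \<phi>) +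
     (\<Sum>j\<in>UNIV. distr_mult (\<lambda>x. b x $ j) (distr_partial (axis j 1) w) \<phi>)"

definition hypoelliptic ::
    "(real ^ 'n \<Rightarrow> real ^ 'n ^ 'n) \<Rightarrow> (real ^ 'n \<Rightarrow> real ^ 'n) \<Rightarrow> bool" where
  "hypoelliptic A b \<longleftrightarrow>
     (\<forall>\<Omega> w. open \<Omega> \<and> distribution_on \<Omega> w \<and> smooth_distribution_on \<Omega> (distr_diff_op A b w)
        \<longrightarrow> smooth_distribution_on \<Omega> w)"

section \<open>Lie groups on \<open>\<real>\<^sup>n\<close> and invariance\<close>

text \<open>The manifold structure is the standard one; the neutral element need not be \<open>0\<close>.\<close>

definition lie_group :: "(real ^ 'n) monoid \<Rightarrow> bool" where
  "lie_group G \<longleftrightarrow>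
     group G \<and> carrier G = UNIV \<and>
     smooth_on (\<lambda>(x, y). x \<otimes>\<^bsub>G\<^esub> y) UNIV \<and> smooth_on (\<lambda>x. inv\<^bsub>G\<^esub> x) UNIV"

definition left_translation_invariant ::
    "(real ^ 'n) monoid \<Rightarrow> (real ^ 'n \<Rightarrow> real ^ 'n ^ 'n) \<Rightarrow> (real ^ 'n \<Rightarrow> real ^ 'n) \<Rightarrow> bool" where
  "left_translation_invariant G A b \<longleftrightarrow>
     (\<forall>\<alpha> x w. smooth_on w UNIV \<longrightarrow>
        diff_op A b (\<lambda>y. w (\<alpha> \<otimes>\<^bsub>G\<^esub> y)) x = diff_op A b w (\<alpha> \<otimes>\<^bsub>G\<^esub> x))"

definition left_invariant_measure :: "'a monoid \<Rightarrow> 'a measure \<Rightarrow> bool" where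
  "left_invariant_measure G M \<longleftrightarrow>
     (\<forall>\<alpha>\<in>carrier G. \<forall>E\<in>sets M.
        (\<lambda>x. \<alpha> \<otimes>\<^bsub>G\<^esub> x) ` E \<in> sets M \<and> emeasure M ((\<lambda>x. \<alpha> \<otimes>\<^bsub>G\<^esub> x) ` E) = emeasure M E)"

definition right_invariant_measure :: "'a monoid \<Rightarrow> 'a measure \<Rightarrow> bool" where
  "right_invariant_measure G M \<longleftrightarrow>
     (\<forall>\<alpha>\<in>carrier G. \<forall>E\<in>sets M.
        (\<lambda>x. x \<otimes>\<^bsub>G\<^esub> \<alpha>) ` E \<in> sets M \<and> emeasure M ((\<lambda>x. x \<otimes>\<^bsub>G\<^esub> \<alpha>) ` E) = emeasure M E)"

section \<open>The spaces \<open>L\<^sup>q\<close>\<close>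

definition Lq_space :: "real \<Rightarrow> 'a measure \<Rightarrow> ('a \<Rightarrow> real) set" where
  "Lq_space q M = {f. f \<in> borel_measurable M \<and> integrable M (\<lambda>x. \<bar>f x\<bar> powr q)}"

end

theory Submission
  imports Defs
begin

text \<open>Let \<open>v = |u|\<^sup>p\<^sup>+\<^sup>1\<close> and let \<open>w x\<close> be the integral of \<open>v (\<alpha> \<circ> x)\<close> over \<open>\<alpha>\<close> in a fixed cube \<open>K\<close>. By right
  invariance of Lebesgue measure \<open>w x\<close> is the integral of the integrable function \<open>v\<close> over \<open>K \<circ> x\<close>,
  so \<open>w\<close> tends to \<open>0\<close> at infinity; if \<open>w\<close> is not identically \<open>0\<close>, it attains its maximum at some \<open>x\<^sub>0\<close>.
  At \<open>x\<^sub>0\<close> the operator is a sum of squares of directional derivatives plus a first-order term,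
  hence a limit of difference quotients that are positive combinations of increments
  \<open>f y - f x\<^sub>0\<close>. These quotients are nonpositive for \<open>w\<close>, and by convexity of \<open>t \<mapsto> |t|\<^sup>p\<^sup>+\<^sup>1\<close> and left
  invariance their limit is at least the integral over \<open>K\<close> of \<open>(p + 1) |u (\<alpha> \<circ> x\<^sub>0)|\<^sup>2\<^sup>p\<close>. So \<open>u\<close> vanishes
  on \<open>K \<circ> x\<^sub>0\<close> and \<open>w x\<^sub>0 = 0\<close>. Working with difference quotients avoids differentiating \<open>w\<close>.\<close>

section \<open>Calculus of \<open>C\<^sup>k\<close> functions\<close>

lemma partial_deriv_eqI:
  "(f has_derivative f') (at x) \<Longrightarrow> partial_deriv v f x = f' v"
  unfolding partial_deriv_def by (simp add: frechet_derivative_at[symmetric])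

lemma has_derivative_partial_deriv:
  "f differentiable (at x) \<Longrightarrow> (f has_derivative (\<lambda>v. partial_deriv v f x)) (at x)"
  unfolding partial_deriv_def by (simp add: frechet_derivative_works[symmetric])

lemma linear_partial_deriv:
  "f differentiable (at x) \<Longrightarrow> linear (\<lambda>v. partial_deriv v f x)"
  by (rule has_derivative_linear[OF has_derivative_partial_deriv])

lemma partial_deriv_Basis_sum:
  fixes f :: "'a::euclidean_space \<Rightarrow> real"
  assumes "f differentiable (at x)"
  shows "partial_deriv v f x = (\<Sum>i\<in>Basis. (v \<bullet> i) * partial_deriv i f x)"
proof -
  interpret linear "\<lambda>v. partial_deriv v f x" by (rule linear_partial_deriv[OF assms])
  have "partial_deriv v f x = partial_deriv (\<Sum>i\<in>Basis. (v \<bullet> i) *\<^sub>R i) f x"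
    by (simp add: euclidean_representation)
  then show ?thesis by (simp add: sum scale)
qed

lemma Ck_on_SucD: "Ck_on (Suc k) f UNIV \<Longrightarrow> Ck_on k f UNIV"
proof (induction k arbitrary: f)
  case 0
  then show ?case
    by (auto simp: continuous_on_eq_continuous_within intro: differentiable_imp_continuous_within)
next
  case (Suc k)
  then show ?case by (metis Ck_on.simps(2))
qed

lemma Ck_on_mono: "Ck_on k f UNIV \<Longrightarrow> l \<le> k \<Longrightarrow> Ck_on l f UNIV"
proof (induction k)
  case (Suc k)
  then show ?case using Ck_on_SucD le_Suc_eq by metis
qed simp

lemma Ck_on_differentiable: "Ck_on k f UNIV \<Longrightarrow> 1 \<le> k \<Longrightarrow> f differentiable (at x)"
  by (cases k) auto

lemma Ck_on_continuous: "Ck_on k f UNIV \<Longrightarrow> continuous_on UNIV f"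
  using Ck_on_mono[of k f 0] by simp

section \<open>Stability of the classes under algebraic operations and composition\<close>

lemma Ck_on_const: "Ck_on k (\<lambda>x. c) UNIV"
proof (induction k arbitrary: c)
  case (Suc k)
  have "partial_deriv i (\<lambda>x. c) = (\<lambda>x. 0)" for i :: 'a
    by (rule ext) (simp add: partial_deriv_def)
  then show ?case using Suc by simp
qed simp

lemma Ck_on_add:
  "Ck_on k f UNIV \<Longrightarrow> Ck_on k g UNIV \<Longrightarrow> Ck_on k (\<lambda>x. f x + g x) UNIV"
proof (induction k arbitrary: f g)
  case (Suc k)
  have "partial_deriv i (\<lambda>x. f x + g x) = (\<lambda>x. partial_deriv i f x + partial_deriv i g x)" for i
    by (rule ext, rule partial_deriv_eqI)
      (use Suc.prems in \<open>auto intro!: has_derivative_add has_derivative_partial_deriv\<close>)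
  then show ?case using Suc by simp
qed (auto intro: continuous_intros)

lemma Ck_on_mult:
  fixes f g :: "'a::euclidean_space \<Rightarrow> real"
  shows "Ck_on k f UNIV \<Longrightarrow> Ck_on k g UNIV \<Longrightarrow> Ck_on k (\<lambda>x. f x * g x) UNIV"
proof (induction k arbitrary: f g)
  case (Suc k)
  have "partial_deriv i (\<lambda>x. f x * g x) = (\<lambda>x. f x * partial_deriv i g x + partial_deriv i f x * g x)" for i
    by (rule ext, rule partial_deriv_eqI)
      (use Suc.prems in \<open>auto intro!: has_derivative_mult has_derivative_partial_deriv\<close>)
  moreover have "Ck_on k f UNIV" "Ck_on k g UNIV" by (rule Suc.prems[THEN Ck_on_SucD])+
  ultimately show ?case using Suc by (auto intro!: Ck_on_add)
qed (auto intro: continuous_intros)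

lemma Ck_on_sum:
  "(\<And>i. i \<in> I \<Longrightarrow> Ck_on k (f i) UNIV) \<Longrightarrow> Ck_on k (\<lambda>x. \<Sum>i\<in>I. f i x) UNIV"
  by (induction I rule: infinite_finite_induct) (auto intro: Ck_on_add Ck_on_const)

lemma Ck_on_diff:
  fixes f g :: "'a::euclidean_space \<Rightarrow> real"
  assumes "Ck_on k f UNIV" "Ck_on k g UNIV"
  shows "Ck_on k (\<lambda>x. f x - g x) UNIV"
  using Ck_on_add[OF assms(1) Ck_on_mult[OF Ck_on_const[of k "-1"] assms(2)]] by simp

lemma Ck_on_bounded_linear:
  assumes "bounded_linear h"
  shows "Ck_on k f UNIV \<Longrightarrow> Ck_on k (\<lambda>x. h (f x)) UNIV"
proof (induction k arbitrary: f)
  case 0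
  then show ?case using assms by (auto intro: bounded_linear.continuous_on)
next
  case (Suc k)
  have D: "((\<lambda>x. h (f x)) has_derivative (\<lambda>v. h (partial_deriv v f x))) (at x)" for x
    using Suc.prems
    by (auto intro!: bounded_linear.has_derivative[OF assms] has_derivative_partial_deriv)
  then have "partial_deriv i (\<lambda>x. h (f x)) = (\<lambda>x. h (partial_deriv i f x))" for i
    by (intro ext partial_deriv_eqI)
  then show ?case using Suc D by (auto simp: differentiable_def)
qed

lemma Ck_on_ident: "Ck_on k (\<lambda>x. x) UNIV"
proof (cases k)
  case (Suc l)
  have "partial_deriv i (\<lambda>x. x) = (\<lambda>x::'a. i)" for i
    by (rule ext) (simp add: partial_deriv_def)
  then show ?thesis using Suc by (simp add: Ck_on_const)
qed simp

lemma Ck_on_inner_left: "Ck_on k (\<lambda>x. (x::'a::euclidean_space) \<bullet> j) UNIV"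
  by (rule Ck_on_bounded_linear[OF bounded_linear_inner_left Ck_on_ident])

text \<open>Chain rule in which the inner map enters only through its real components: every partial
  derivative of the composition becomes a finite sum of products, the shape that
  \<open>Ck_on_sum\<close> and \<open>Ck_on_mult\<close> can handle.\<close>

lemma has_derivative_compose_components:
  fixes f :: "'b::euclidean_space \<Rightarrow> real" and g :: "'a::euclidean_space \<Rightarrow> 'b"
  assumes f: "f differentiable (at (g x))"
    and g: "\<And>j. j \<in> Basis \<Longrightarrow> (\<lambda>x. g x \<bullet> j) differentiable (at x)"
  shows "((\<lambda>x. f (g x)) has_derivative
      (\<lambda>v. \<Sum>j\<in>Basis. partial_deriv j f (g x) * partial_deriv v (\<lambda>x. g x \<bullet> j) x)) (at x)"
proof -
  have "(g has_derivative (\<lambda>v. \<Sum>j\<in>Basis. partial_deriv v (\<lambda>x. g x \<bullet> j) x *\<^sub>R j)) (at x)"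
    by (subst has_derivative_componentwise_within)
      (use g in \<open>auto simp: inner_sum_left inner_Basis if_distrib[of "(*) _"] intro!: has_derivative_partial_deriv cong: if_cong\<close>)
  from has_derivative_compose[OF this has_derivative_partial_deriv[OF f]]
  show ?thesis
    by (subst (asm) partial_deriv_Basis_sum[OF f])
       (simp add: inner_sum_left inner_Basis if_distrib mult.commute cong: if_cong)
qed

text \<open>Induction on \<open>k\<close> with \<open>g\<close> fixed and \<open>f\<close> varying:
  the chain rule produces compositions of \<open>g\<close> with the partial derivatives of
  \<open>f\<close>, which have one order of smoothness less.\<close>

lemma Ck_on_compose:
  fixes f :: "'b::euclidean_space \<Rightarrow> real" and g :: "'a::euclidean_space \<Rightarrow> 'b"
  shows "Ck_on k f UNIV \<Longrightarrow> (\<And>j. j \<in> Basis \<Longrightarrow> Ck_on k (\<lambda>x. g x \<bullet> j) UNIV) \<Longrightarrow>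
    Ck_on k (\<lambda>x. f (g x)) UNIV"
proof (induction k arbitrary: f)
  case 0
  then have "continuous_on UNIV g" by (subst continuous_on_componentwise) auto
  then show ?case using 0 by (auto intro: continuous_on_compose2)
next
  case (Suc k)
  have D: "((\<lambda>x. f (g x)) has_derivative
      (\<lambda>v. \<Sum>j\<in>Basis. partial_deriv j f (g x) * partial_deriv v (\<lambda>x. g x \<bullet> j) x)) (at x)" for x
    by (rule has_derivative_compose_components) (use Suc.prems in auto)
  then have "partial_deriv i (\<lambda>x. f (g x)) =
      (\<lambda>x. \<Sum>j\<in>Basis. partial_deriv j f (g x) * partial_deriv i (\<lambda>x. g x \<bullet> j) x)" for i
    by (intro ext partial_deriv_eqI)
  moreover have "Ck_on k (\<lambda>x. g x \<bullet> j) UNIV" if "j \<in> Basis" for j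
    by (rule Ck_on_SucD[OF Suc.prems(2)[OF that]])
  moreover have "(\<lambda>x. f (g x)) differentiable (at x)" for x
    using D by (rule differentiableI)
  ultimately show ?case using Suc by (auto intro!: Ck_on_sum Ck_on_mult)
qed

text \<open>\<open>Ck_on\<close> speaks of basis directions only; linearity of the derivative in its
  direction reaches every \<open>v\<close>.\<close>

lemma Ck_on_partial_deriv:
  fixes f :: "'a::euclidean_space \<Rightarrow> real"
  assumes "Ck_on (Suc k) f UNIV"
  shows "Ck_on k (partial_deriv v f) UNIV"
proof -
  have "partial_deriv v f = (\<lambda>x. \<Sum>i\<in>Basis. (v \<bullet> i) * partial_deriv i f x)"
    using assms by (intro ext partial_deriv_Basis_sum) auto
  then show ?thesis using assms by (auto intro!: Ck_on_sum Ck_on_mult Ck_on_const)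
qed

lemma Ck_on_1_partial_deriv:
  fixes f :: "'a::euclidean_space \<Rightarrow> real"
  shows "Ck_on 2 f UNIV \<Longrightarrow> Ck_on 1 (partial_deriv v f) UNIV"
  by (rule Ck_on_partial_deriv) (simp only: Suc_1)

lemma partial_deriv_differentiable:
  fixes f :: "'a::euclidean_space \<Rightarrow> real"
  shows "Ck_on 2 f UNIV \<Longrightarrow> partial_deriv v f differentiable (at x)"
  by (rule Ck_on_differentiable[OF Ck_on_1_partial_deriv]) simp_all

section \<open>Slices with the first variable frozen\<close>

lemma partial_deriv_slice:
  assumes "f differentiable (at (a, x))"
  shows "partial_deriv v (\<lambda>y. f (a, y)) x = partial_deriv (0, v) f (a, x)"
proof (rule partial_deriv_eqI)
  have "((\<lambda>y. (a, y)) has_derivative (\<lambda>v. (0, v))) (at x)"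
    by (intro derivative_eq_intros) auto
  from has_derivative_compose[OF this has_derivative_partial_deriv[OF assms]]
  show "((\<lambda>y. f (a, y)) has_derivative (\<lambda>v. partial_deriv (0, v) f (a, x))) (at x)" .
qed

text \<open>Serves to obtain continuity in the parameter \<open>a\<close> and bounds uniform in
  \<open>a\<close>: the second derivatives of all slices are values of a single continuous function
  of both variables.\<close>

lemma partial_deriv2_slice:
  fixes f :: "'a::euclidean_space \<times> 'b::euclidean_space \<Rightarrow> real"
  assumes "Ck_on 2 f UNIV"
  shows "partial_deriv v (partial_deriv v (\<lambda>y. f (a, y))) x =
    partial_deriv (0, v) (partial_deriv (0, v) f) (a, x)"
proof -
  have 1: "Ck_on 1 (partial_deriv (0, v) f) UNIV"
    by (rule Ck_on_1_partial_deriv[OF assms])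
  have "partial_deriv v (\<lambda>y. f (a, y)) = (\<lambda>y. partial_deriv (0, v) f (a, y))"
    using Ck_on_differentiable[OF assms] by (intro ext partial_deriv_slice) auto
  then show ?thesis using Ck_on_differentiable[OF 1] by (simp add: partial_deriv_slice)
qed

lemma Ck_on_slice:
  fixes f :: "'a::euclidean_space \<times> 'b::euclidean_space \<Rightarrow> real"
  assumes "Ck_on k f UNIV"
  shows "Ck_on k (\<lambda>y. f (a, y)) UNIV"
proof (rule Ck_on_compose[OF assms])
  fix j :: "'a \<times> 'b" assume "j \<in> Basis"
  have "(\<lambda>y. (a, y) \<bullet> j) = (\<lambda>y. a \<bullet> fst j + y \<bullet> snd j)"
    by (simp add: inner_prod_def)
  then show "Ck_on k (\<lambda>y. (a, y) \<bullet> j) UNIV"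
    by (simp add: Ck_on_add Ck_on_const Ck_on_inner_left)
qed

section \<open>Mean value formulas along lines\<close>

lemma DERIV_along_line:
  fixes f :: "'a::euclidean_space \<Rightarrow> real"
  assumes "f differentiable (at (x + t *\<^sub>R v))"
  shows "((\<lambda>t. f (x + t *\<^sub>R v)) has_real_derivative partial_deriv v f (x + t *\<^sub>R v)) (at t)"
proof -
  interpret linear "\<lambda>w. partial_deriv w f (x + t *\<^sub>R v)" by (rule linear_partial_deriv[OF assms])
  have "((\<lambda>t. x + t *\<^sub>R v) has_derivative (\<lambda>s. s *\<^sub>R v)) (at t)"
    by (intro derivative_eq_intros) auto
  from has_derivative_compose[OF this has_derivative_partial_deriv[OF assms]]
  show ?thesis
    unfolding has_field_derivative_def by (simp add: scale mult.commute[of _ "partial_deriv v f _"])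
qed

text \<open>Maclaurin's formula of order two for the even function
  \<open>f (x + t v) + f (x - t v)\<close> of \<open>t\<close>; its first derivative vanishes at
  \<open>0\<close>, so no linear term survives.\<close>

lemma second_difference_mean_value:
  fixes f :: "'a::euclidean_space \<Rightarrow> real"
  assumes f: "Ck_on 2 f UNIV" and h: "0 < h"
  obtains t where "0 < t" "t < h"
    "f (x + h *\<^sub>R v) + f (x - h *\<^sub>R v) - 2 * f x =
      h\<^sup>2 / 2 * (partial_deriv v (partial_deriv v f) (x + t *\<^sub>R v) + partial_deriv v (partial_deriv v f) (x - t *\<^sub>R v))"
proof -
  let ?f1 = "partial_deriv v f" and ?f2 = "partial_deriv v (partial_deriv v f)"
  have f1: "Ck_on 1 ?f1 UNIV"
    by (rule Ck_on_1_partial_deriv[OF f])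
  \<comment> \<open>\<open>G m\<close> is the \<open>m\<close>-th derivative in \<open>t\<close> of
    this even function, for \<open>m\<close> up to \<open>2\<close>; the minus sign is written as
    the direction \<open>- v\<close> so that one line formula serves both summands.\<close>
  define G where "G m t = (if m = 0 then f (x + t *\<^sub>R v) + f (x + t *\<^sub>R (- v))
      else if m = 1 then ?f1 (x + t *\<^sub>R v) - ?f1 (x + t *\<^sub>R (-v))
      else ?f2 (x + t *\<^sub>R v) + ?f2 (x + t *\<^sub>R (- v)))" for m :: nat and t
  have neg: "partial_deriv (- v) g y = - partial_deriv v g y"
    if "Ck_on 1 g UNIV" for g :: "'a \<Rightarrow> real" and y
    using linear_neg[OF linear_partial_deriv[OF Ck_on_differentiable[OF that]]] by simp
  have f': "Ck_on 1 f UNIV" by (rule Ck_on_mono[OF f]) simp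
  have d: "((\<lambda>t. g (x + t *\<^sub>R w)) has_real_derivative partial_deriv w g (x + t *\<^sub>R w)) (at t)"
    if "Ck_on 1 g UNIV" for g :: "'a \<Rightarrow> real" and t w
    by (rule DERIV_along_line[OF Ck_on_differentiable[OF that]]) simp
  have G: "G 0 = (\<lambda>t. f (x + t *\<^sub>R v) + f (x + t *\<^sub>R (- v)))"
    "G 1 = (\<lambda>t. ?f1 (x + t *\<^sub>R v) - ?f1 (x + t *\<^sub>R (- v)))"
    "G 2 = (\<lambda>t. ?f2 (x + t *\<^sub>R v) + ?f2 (x + t *\<^sub>R (- v)))"
    by (simp_all add: G_def fun_eq_iff)
  have D0: "DERIV (G 0) t :> G 1 t" for t
    using DERIV_add[OF d[OF f', of v t] d[OF f', of "-v" t]]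
    unfolding G neg[OF f'] by simp
  have D1: "DERIV (G 1) t :> G 2 t" for t
    using DERIV_diff[OF d[OF f1, of v t] d[OF f1, of "-v" t]]
    unfolding G neg[OF f1] by simp
  have "\<exists>t>0. t < h \<and> G 0 h = (\<Sum>m<2. G m 0 / fact m * h ^ m) + G 2 t / fact 2 * h ^ 2"
  proof (rule Maclaurin[OF h])
    show "\<forall>m t. m < 2 \<and> 0 \<le> t \<and> t \<le> h \<longrightarrow> DERIV (G m) t :> G (Suc m) t"
      using D0 D1 by (metis One_nat_def Suc_1 less_2_cases_iff)
  qed auto
  then obtain t where "0 < t" "t < h"
    "G 0 h = (\<Sum>m<2. G m 0 / fact m * h ^ m) + G 2 t / fact 2 * h ^ 2" by auto
  then show ?thesis by (intro that[of t]) (auto simp: G_def numeral_2_eq_2)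
qed

lemma first_difference_mean_value:
  fixes f :: "'a::euclidean_space \<Rightarrow> real"
  assumes f: "Ck_on 1 f UNIV" and h: "0 < h"
  obtains t where "0 < t" "t < h" "f (x + h *\<^sub>R v) - f x = h * partial_deriv v f (x + t *\<^sub>R v)"
  using MVT2[OF h DERIV_along_line[OF Ck_on_differentiable[OF f]], of x v] by auto

section \<open>Second-order operators as sums of squares\<close>

text \<open>The quadratic polynomial in \<open>t\<close> given by the form at \<open>x + t y\<close>
  is nonnegative. If its leading coefficient is zero, its linear coefficient must vanish too;
  otherwise its minimum is nonnegative.\<close>

lemma psd_Cauchy_Schwarz:
  fixes M :: "real ^ 'n ^ 'n"
  assumes sym: "transpose M = M" and psd: "\<And>\<xi>. (M *v \<xi>) \<bullet> \<xi> \<ge> 0"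
  shows "((M *v x) \<bullet> y)\<^sup>2 \<le> ((M *v x) \<bullet> x) * ((M *v y) \<bullet> y)"
proof -
  have s: "(M *v y) \<bullet> x = (M *v x) \<bullet> y"
    using dot_lmul_matrix[of x M y] sym
    by (metis inner_commute transpose_matrix_vector)
  have q: "0 \<le> (M *v x) \<bullet> x + 2 * t * ((M *v x) \<bullet> y) + t\<^sup>2 * ((M *v y) \<bullet> y)" for t
    using psd[of "x + t *\<^sub>R y"]
    by (simp add: matrix_vector_right_distrib matrix_vector_mult_scaleR inner_add_left
        inner_add_right s power2_eq_square algebra_simps)
  show ?thesis
  proof (cases "(M *v y) \<bullet> y = 0")
    case True
    have "(M *v x) \<bullet> y = 0"
    proof (rule ccontr)
      assume n: "(M *v x) \<bullet> y \<noteq> 0"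
      \<comment> \<open>At this \<open>t\<close> the polynomial would take the value
        \<open>-1\<close>.\<close>
      show False
        using q[of "- ((M *v x) \<bullet> x + 1) / (2 * ((M *v x) \<bullet> y))"] n True by (simp add: field_simps)
    qed
    then show ?thesis using True by simp
  next
    case False
    then have pos: "(M *v y) \<bullet> y > 0" using psd[of y] by simp
    have "0 \<le> (M *v x) \<bullet> x - ((M *v x) \<bullet> y)\<^sup>2 / ((M *v y) \<bullet> y)"
      using q[of "- ((M *v x) \<bullet> y) / ((M *v y) \<bullet> y)"] pos
      by (simp add: power2_eq_square field_simps)
    then show ?thesis using pos by (simp add: field_simps)
  qed
qed

lemma matrix_vector_mult_axis: "((M :: real ^ 'n ^ 'm) *v axis s 1) $ i = M $ i $ s"
  by (simp add: matrix_vector_mult_basis column_def)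

text \<open>Inductive Cholesky factorisation: one index of the support \<open>S\<close> is
  eliminated at a time, the remainder being a Schur complement. Bounding the row indices by
  \<open>S\<close> also bounds the column indices, by symmetry.\<close>

lemma psd_sum_of_squares_on:
  fixes M :: "real ^ 'n ^ 'n"
  assumes "finite S" "transpose M = M" "\<And>\<xi>. (M *v \<xi>) \<bullet> \<xi> \<ge> 0"
    and "\<And>i j. M $ i $ j \<noteq> 0 \<Longrightarrow> i \<in> S"
  shows "\<exists>X :: 'n \<Rightarrow> real ^ 'n. \<forall>i j. M $ i $ j = (\<Sum>k\<in>S. X k $ i * X k $ j)"
  using assms
proof (induction S arbitrary: M rule: finite_induct)
  case empty
  then show ?case by auto
next
  case (insert s S)
  define a where "a = M $ s $ s"
  have sym: "M $ i $ j = M $ j $ i" for i j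
    using insert.prems(1) by (metis transpose_def vec_lambda_beta)
  have cs: "((M *v axis s 1) \<bullet> \<xi>)\<^sup>2 \<le> a * ((M *v \<xi>) \<bullet> \<xi>)" for \<xi>
    using psd_Cauchy_Schwarz[OF insert.prems(1,2), of "axis s 1" \<xi>]
    by (simp add: inner_axis matrix_vector_mult_axis a_def)
  have a0: "a \<ge> 0"
    using insert.prems(2)[of "axis s 1"] by (simp add: inner_axis matrix_vector_mult_axis a_def)
  show ?case
  proof (cases "a = 0")
    case True
    \<comment> \<open>With a zero diagonal entry, Cauchy-Schwarz forces column \<open>s\<close> and,
      by symmetry, row \<open>s\<close> to vanish; the zero vector then serves at index
      \<open>s\<close>.\<close>
    have "M $ i $ s = 0" for i
      using cs[of "axis i 1"] True by (simp add: inner_axis matrix_vector_mult_axis)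
    then have "i \<in> S" if "M $ i $ j \<noteq> 0" for i j
      using that insert.prems(3)[OF that] sym[of s j] by auto
    then obtain X :: "'n \<Rightarrow> real ^ 'n" where X: "\<And>i j. M $ i $ j = (\<Sum>k\<in>S. X k $ i * X k $ j)"
      using insert.IH[OF insert.prems(1,2)] by metis
    have "M $ i $ j = (\<Sum>k\<in>insert s S. (X(s := 0)) k $ i * (X(s := 0)) k $ j)" for i j
      using insert.hyps by (auto simp: X intro!: sum.cong)
    then show ?thesis by blast
  next
    case False
    then have a: "a > 0" using a0 by simp
    \<comment> \<open>Schur complement of the entry \<open>a\<close>: subtracting the rank-one
      square of column \<open>s\<close> clears row and column \<open>s\<close>, and
      \<open>cs\<close> says exactly that the remainder is still positive semidefinite.\<close>
    define N :: "real ^ 'n ^ 'n" where "N = (\<chi> i j. M $ i $ j - M $ i $ s * M $ j $ s / a)"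
    have Nv: "N *v \<xi> = M *v \<xi> - (((M *v axis s 1) \<bullet> \<xi>) / a) *\<^sub>R (M *v axis s 1)" for \<xi>
    proof -
      have c: "(M *v axis s 1) \<bullet> \<xi> = (\<Sum>j\<in>UNIV. M $ j $ s * \<xi> $ j)"
        by (simp add: inner_vec_def matrix_vector_mult_axis)
      show ?thesis
        unfolding c
        by (simp add: vec_eq_iff matrix_vector_mult_axis)
           (simp add: matrix_vector_mult_def N_def left_diff_distrib right_diff_distrib sum_subtractf
             sum_divide_distrib sum_distrib_left mult_ac)
    qed
    have "transpose N = N"
      by (simp add: vec_eq_iff transpose_def N_def sym mult.commute)
    moreover have "(N *v \<xi>) \<bullet> \<xi> \<ge> 0" for \<xi>
      using cs[of \<xi>] a by (simp add: Nv inner_diff_left power2_eq_square field_simps)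
    moreover have "i \<in> S" if "N $ i $ j \<noteq> 0" for i j
    proof -
      have "i \<noteq> s" using that a sym[of s j] by (auto simp: N_def a_def)
      moreover have "i \<in> insert s S"
      proof (cases "M $ i $ j = 0")
        case True
        then have "M $ i $ s \<noteq> 0" using that by (auto simp: N_def)
        then show ?thesis by (rule insert.prems(3))
      qed (rule insert.prems(3))
      ultimately show ?thesis by simp
    qed
    ultimately obtain X :: "'n \<Rightarrow> real ^ 'n"
      where X: "\<And>i j. N $ i $ j = (\<Sum>k\<in>S. X k $ i * X k $ j)"
      using insert.IH[of N] by metis
    \<comment> \<open>The scaled column restores the subtracted square: its coordinate products are
      \<open>M $ i $ s * M $ j $ s / a\<close>.\<close>
    let ?Y = "X(s := (1 / sqrt a) *\<^sub>R (M *v axis s 1))"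
    have "M $ i $ j = (\<Sum>k\<in>insert s S. ?Y k $ i * ?Y k $ j)" for i j
    proof -
      have "(\<Sum>k\<in>S. ?Y k $ i * ?Y k $ j) = N $ i $ j"
        unfolding X using insert.hyps by (intro sum.cong) auto
      then show ?thesis
        using insert.hyps a by (simp add: N_def matrix_vector_mult_axis)
    qed
    then show ?thesis by blast
  qed
qed

lemma psd_sum_of_squares:
  fixes M :: "real ^ 'n ^ 'n"
  assumes "transpose M = M" "\<And>\<xi>. (M *v \<xi>) \<bullet> \<xi> \<ge> 0"
  shows "\<exists>X :: 'n \<Rightarrow> real ^ 'n. \<forall>i j. M $ i $ j = (\<Sum>k\<in>UNIV. X k $ i * X k $ j)"
  by (rule psd_sum_of_squares_on[OF finite assms UNIV_I])

section \<open>From the coefficient matrix to the operator\<close>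

lemma partial_deriv_vec_sum:
  fixes f :: "real ^ 'n \<Rightarrow> real"
  assumes "f differentiable (at x)"
  shows "partial_deriv v f x = (\<Sum>i\<in>UNIV. v $ i * partial_deriv (axis i 1) f x)"
proof -
  interpret linear "\<lambda>v. partial_deriv v f x" by (rule linear_partial_deriv[OF assms])
  have "partial_deriv v f x = partial_deriv (\<Sum>i\<in>UNIV. (v $ i) *\<^sub>R axis i 1) f x"
    by (simp add: basis_expansion flip: scalar_mult_eq_scaleR)
  then show ?thesis by (simp add: sum scale)
qed

lemma partial_deriv2_vec_sum:
  fixes f :: "real ^ 'n \<Rightarrow> real"
  assumes f: "Ck_on 2 f UNIV"
  shows "partial_deriv v (partial_deriv v f) x =
    (\<Sum>i\<in>UNIV. \<Sum>j\<in>UNIV. v $ i * v $ j * partial_deriv (axis i 1) (partial_deriv (axis j 1) f) x)"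
proof -
  have d: "partial_deriv w f differentiable (at x)" for w
    by (rule partial_deriv_differentiable[OF f])
  have "partial_deriv v f = (\<lambda>y. \<Sum>j\<in>UNIV. v $ j * partial_deriv (axis j 1) f y)"
    using Ck_on_differentiable[OF f] by (intro ext partial_deriv_vec_sum) auto
  then have "partial_deriv v (partial_deriv v f) x =
      (\<Sum>j\<in>UNIV. v $ j * partial_deriv v (partial_deriv (axis j 1) f) x)"
    by (simp only:, intro partial_deriv_eqI has_derivative_sum has_derivative_mult_right
        has_derivative_partial_deriv d)
  also have "\<dots> = (\<Sum>j\<in>UNIV. \<Sum>i\<in>UNIV. v $ i * v $ j *
      partial_deriv (axis i 1) (partial_deriv (axis j 1) f) x)"
    by (subst partial_deriv_vec_sum[OF d]) (simp add: sum_distrib_left mult_ac)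
  finally show ?thesis by (subst sum.swap)
qed

text \<open>Product rule: the derivatives of the coefficients join the drift.\<close>

lemma diff_op_nondivergence_form:
  assumes A: "\<And>i j. Ck_on 1 (\<lambda>x. A x $ i $ j) UNIV" and f: "Ck_on 2 f UNIV"
  shows "diff_op A b f x =
    (\<Sum>i\<in>UNIV. \<Sum>j\<in>UNIV. A x $ i $ j * partial_deriv (axis i 1) (partial_deriv (axis j 1) f) x) +
    partial_deriv (\<chi> j. b x $ j + (\<Sum>i\<in>UNIV. partial_deriv (axis i 1) (\<lambda>y. A y $ i $ j) x)) f x"
proof -
  have d: "partial_deriv w f differentiable (at x)" for w
    by (rule partial_deriv_differentiable[OF f])
  have dA: "(\<lambda>x. A x $ i $ j) differentiable (at x)" for i j
    by (rule Ck_on_differentiable[OF A]) simp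
  have "partial_deriv (axis i 1) (\<lambda>y. (A y *v gradient f y) $ i) x =
     (\<Sum>j\<in>UNIV. A x $ i $ j * partial_deriv (axis i 1) (partial_deriv (axis j 1) f) x +
        partial_deriv (axis i 1) (\<lambda>y. A y $ i $ j) x * partial_deriv (axis j 1) f x)" for i
    unfolding matrix_vector_mult_def gradient_def vec_lambda_beta
    by (intro partial_deriv_eqI has_derivative_sum has_derivative_mult
        has_derivative_partial_deriv d dA)
  then have "diff_op A b f x = (\<Sum>i\<in>UNIV. \<Sum>j\<in>UNIV.
        A x $ i $ j * partial_deriv (axis i 1) (partial_deriv (axis j 1) f) x +
        partial_deriv (axis i 1) (\<lambda>y. A y $ i $ j) x * partial_deriv (axis j 1) f x) +
      (\<Sum>j\<in>UNIV. b x $ j * partial_deriv (axis j 1) f x)"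
    by (simp add: diff_op_def divergence_def inner_vec_def gradient_def)
  moreover have "(\<Sum>i\<in>UNIV. \<Sum>j\<in>UNIV. partial_deriv (axis i 1) (\<lambda>y. A y $ i $ j) x * partial_deriv (axis j 1) f x)
     = (\<Sum>j\<in>UNIV. (\<Sum>i\<in>UNIV. partial_deriv (axis i 1) (\<lambda>y. A y $ i $ j) x) * partial_deriv (axis j 1) f x)"
    by (subst sum.swap) (simp add: sum_distrib_right)
  ultimately show ?thesis
    by (subst (3) partial_deriv_vec_sum)
      (use Ck_on_differentiable[OF f] in \<open>auto simp: sum.distrib distrib_right\<close>)
qed

text \<open>The matrix is factored at the single point \<open>x\<close>, so \<open>X\<close> and
  \<open>c\<close> are constant vectors independent of \<open>f\<close>. The second-order part then
  has only repeated derivatives in one direction, which are limits of symmetric second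
  differences.\<close>

lemma diff_op_sum_of_squares:
  assumes A: "\<And>i j. Ck_on 1 (\<lambda>x. A x $ i $ j) UNIV"
    and sym: "transpose (A x) = A x" and psd: "\<And>\<xi>. (A x *v \<xi>) \<bullet> \<xi> \<ge> 0"
  shows "\<exists>(X :: 'n \<Rightarrow> real ^ 'n) c. \<forall>f. Ck_on 2 f UNIV \<longrightarrow>
      diff_op A b f x = (\<Sum>k\<in>UNIV. partial_deriv (X k) (partial_deriv (X k) f) x) + partial_deriv c f x"
proof -
  obtain X :: "'n \<Rightarrow> real ^ 'n" where X: "\<forall>i j. A x $ i $ j = (\<Sum>k\<in>UNIV. X k $ i * X k $ j)"
    using psd_sum_of_squares[OF sym psd] ..
  let ?c = "\<chi> j. b x $ j + (\<Sum>i\<in>UNIV. partial_deriv (axis i 1) (\<lambda>y. A y $ i $ j) x)"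
  show ?thesis
  proof (rule exI[of _ X], rule exI[of _ ?c], intro allI impI)
    fix f :: "real ^ 'n \<Rightarrow> real" assume f: "Ck_on 2 f UNIV"
    let ?D = "\<lambda>i j. partial_deriv (axis i 1) (partial_deriv (axis j 1) f) x"
    have "(\<Sum>i\<in>UNIV. \<Sum>j\<in>UNIV. A x $ i $ j * ?D i j) =
        (\<Sum>i\<in>UNIV. \<Sum>j\<in>UNIV. \<Sum>k\<in>UNIV. X k $ i * X k $ j * ?D i j)"
      by (simp add: X sum_distrib_right)
    also have "\<dots> = (\<Sum>i\<in>UNIV. \<Sum>k\<in>UNIV. \<Sum>j\<in>UNIV. X k $ i * X k $ j * ?D i j)"
      by (intro sum.cong refl sum.swap)
    also have "\<dots> = (\<Sum>k\<in>UNIV. \<Sum>i\<in>UNIV. \<Sum>j\<in>UNIV. X k $ i * X k $ j * ?D i j)"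
      by (rule sum.swap)
    also have "\<dots> = (\<Sum>k\<in>UNIV. partial_deriv (X k) (partial_deriv (X k) f) x)"
      by (simp add: partial_deriv2_vec_sum[OF f])
    finally show "diff_op A b f x =
        (\<Sum>k\<in>UNIV. partial_deriv (X k) (partial_deriv (X k) f) x) + partial_deriv ?c f x"
      by (simp add: diff_op_nondivergence_form[OF A f])
  qed
qed

section \<open>Left invariance for functions of class \<open>C\<^sup>2\<close>\<close>

text \<open>Antisymmetry of the Hessian suffices because second derivatives in a single direction only
  see its symmetric part; this makes the symmetry of second derivatives unnecessary.\<close>

lemma partial_deriv2_compose_flat:
  fixes r :: "'b::euclidean_space \<Rightarrow> real" and g :: "'a::euclidean_space \<Rightarrow> 'b"
  assumes r: "Ck_on 2 r UNIV" and g: "\<And>j. j \<in> Basis \<Longrightarrow> Ck_on 2 (\<lambda>x. g x \<bullet> j) UNIV"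
    and flat: "\<And>j. j \<in> Basis \<Longrightarrow> partial_deriv j r (g x) = 0"
    and antisym: "\<And>i j. i \<in> Basis \<Longrightarrow> j \<in> Basis \<Longrightarrow>
      partial_deriv i (partial_deriv j r) (g x) = - partial_deriv j (partial_deriv i r) (g x)"
  shows "partial_deriv v (\<lambda>x. r (g x)) x = 0"
    and "partial_deriv v (partial_deriv v (\<lambda>x. r (g x))) x = 0"
proof -
  have dg: "(\<lambda>x. g x \<bullet> j) differentiable (at y)" if "j \<in> Basis" for j y
    using Ck_on_differentiable[OF g[OF that]] by simp
  have dr: "r differentiable (at y)" for y
    using Ck_on_differentiable[OF r] by simp
  have 1: "partial_deriv v (\<lambda>x. r (g x)) y =
      (\<Sum>j\<in>Basis. partial_deriv j r (g y) * partial_deriv v (\<lambda>x. g x \<bullet> j) y)" for v y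
    by (rule partial_deriv_eqI, rule has_derivative_compose_components) (auto intro: dr dg)
  then show "partial_deriv v (\<lambda>x. r (g x)) x = 0" by (simp add: flat)
  let ?T = "\<lambda>j. partial_deriv v (\<lambda>x. g x \<bullet> j) x"
  let ?H = "\<lambda>i j. partial_deriv i (partial_deriv j r) (g x)"
  have 2: "((\<lambda>x. partial_deriv j r (g x)) has_derivative
      (\<lambda>v. \<Sum>i\<in>Basis. ?H i j * partial_deriv v (\<lambda>x. g x \<bullet> i) x)) (at x)" for j
    by (rule has_derivative_compose_components) (auto intro: partial_deriv_differentiable[OF r] dg)
  have 3: "((\<lambda>y. \<Sum>j\<in>Basis. partial_deriv j r (g y) * partial_deriv v (\<lambda>x. g x \<bullet> j) y) has_derivative
      (\<lambda>w. \<Sum>j\<in>Basis. partial_deriv j r (g x) * partial_deriv w (partial_deriv v (\<lambda>x. g x \<bullet> j)) x +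
         (\<Sum>i\<in>Basis. ?H i j * partial_deriv w (\<lambda>x. g x \<bullet> i) x) * ?T j)) (at x)"
    by (intro has_derivative_sum has_derivative_mult 2 has_derivative_partial_deriv
        partial_deriv_differentiable g)
  \<comment> \<open>\<open>flat\<close> kills the terms containing second derivatives of
    \<open>g\<close>; what is left is the Hessian form of \<open>r\<close> on the derivative vector
    \<open>?T\<close>.\<close>
  have "partial_deriv v (partial_deriv v (\<lambda>x. r (g x))) x =
      (\<Sum>j\<in>Basis. \<Sum>i\<in>Basis. ?H i j * ?T i * ?T j)" (is "_ = ?S")
    unfolding 1[abs_def] partial_deriv_eqI[OF 3] by (simp add: flat sum_distrib_right)
  moreover have "?S = - ?S"
  proof -
    have "?S = (\<Sum>j\<in>Basis. \<Sum>i\<in>Basis. - (?H j i * ?T j * ?T i))"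
      by (intro sum.cong refl) (subst antisym, auto)
    also have "\<dots> = - (\<Sum>j\<in>Basis. \<Sum>i\<in>Basis. ?H j i * ?T j * ?T i)"
      by (simp only: sum_negf)
    also have "\<dots> = - ?S" by (subst sum.swap) simp
    finally show ?thesis .
  qed
  ultimately show "partial_deriv v (partial_deriv v (\<lambda>x. r (g x))) x = 0" by linarith
qed

text \<open>Splits off a smooth part of \<open>u\<close>. The Hessian of a quadratic polynomial is
  symmetric, so \<open>q\<close> matches the symmetric part of the Hessian of \<open>u\<close> at
  \<open>y\<close> and leaves an antisymmetric remainder.\<close>

lemma second_order_Taylor_polynomial:
  fixes u :: "'a::euclidean_space \<Rightarrow> real"
  assumes u: "Ck_on 2 u UNIV"
  shows "\<exists>q. (\<forall>k. Ck_on k q UNIV) \<and>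
    (\<forall>j\<in>Basis. partial_deriv j (\<lambda>z. u z - q z) y = 0) \<and>
    (\<forall>i\<in>Basis. \<forall>j\<in>Basis. partial_deriv i (partial_deriv j (\<lambda>z. u z - q z)) y =
      - partial_deriv j (partial_deriv i (\<lambda>z. u z - q z)) y)"
proof -
  let ?H = "\<lambda>i j. partial_deriv i (partial_deriv j u) y / 2"
  \<comment> \<open>Taylor polynomial at \<open>y\<close> without its constant term, since only
    derivatives of \<open>u - q\<close> matter; the factor \<open>1/2\<close> sits in
    \<open>?H\<close>.\<close>
  define q where "q z = (\<Sum>j\<in>Basis. partial_deriv j u y * (z \<bullet> j - y \<bullet> j)) +
    (\<Sum>i\<in>Basis. \<Sum>j\<in>Basis. ?H i j * ((z \<bullet> i - y \<bullet> i) * (z \<bullet> j - y \<bullet> j)))" for z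
  define q1 where "q1 v z = (\<Sum>j\<in>Basis. partial_deriv j u y * (v \<bullet> j)) +
    (\<Sum>i\<in>Basis. \<Sum>j\<in>Basis. ?H i j * ((z \<bullet> i - y \<bullet> i) * (v \<bullet> j) + (v \<bullet> i) * (z \<bullet> j - y \<bullet> j)))" for v z
  define q2 where "q2 v w = 
    (\<Sum>i\<in>Basis. \<Sum>j\<in>Basis. ?H i j * ((w \<bullet> i) * (v \<bullet> j) + (v \<bullet> i) * (w \<bullet> j)))" for v w
  have Dq: "(q has_derivative (\<lambda>v. q1 v z)) (at z)" for z
    unfolding q_def[abs_def] q1_def
    by (intro has_derivative_add has_derivative_sum has_derivative_mult_right has_derivative_mult
        has_derivative_diff[where g' = "\<lambda>_. 0", simplified] has_derivative_inner_left
        has_derivative_ident has_derivative_const)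
  have Dq1: "(q1 v has_derivative q2 v) (at z)" for v z
    unfolding q1_def[abs_def] q2_def[abs_def]
    by (auto intro!: derivative_eq_intros simp: algebra_simps)
  have pq: "partial_deriv v q = q1 v" for v
    by (intro ext partial_deriv_eqI Dq)
  have pr: "partial_deriv v (\<lambda>z. u z - q z) = (\<lambda>z. partial_deriv v u z - q1 v z)" for v
    by (intro ext partial_deriv_eqI has_derivative_diff Dq has_derivative_partial_deriv
        Ck_on_differentiable[OF u]) simp
  have pr2: "partial_deriv w (partial_deriv v (\<lambda>z. u z - q z)) y =
      partial_deriv w (partial_deriv v u) y - q2 v w" for v w
    unfolding pr by (intro partial_deriv_eqI has_derivative_diff Dq1 has_derivative_partial_deriv
        partial_deriv_differentiable[OF u])
  have delta: "(\<Sum>i\<in>Basis. f i * (v \<bullet> i)) = f v" if "v \<in> Basis" for f and v :: 'a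
    using that by (simp add: inner_Basis if_distrib cong: if_cong)
  have q2: "q2 v w = ?H w v + ?H v w" if "v \<in> Basis" "w \<in> Basis" for v w
  proof -
    have "q2 v w = (\<Sum>i\<in>Basis. (\<Sum>j\<in>Basis. ?H i j * (v \<bullet> j)) * (w \<bullet> i)) +
       (\<Sum>i\<in>Basis. (\<Sum>j\<in>Basis. ?H i j * (w \<bullet> j)) * (v \<bullet> i))"
      unfolding q2_def by (simp add: sum.distrib distrib_left sum_distrib_left sum_distrib_right mult_ac)
    then show ?thesis by (simp only: delta that)
  qed
  show ?thesis
  proof (intro exI[of _ q] conjI allI ballI)
    show "Ck_on k q UNIV" for k
      unfolding q_def[abs_def]
      by (intro Ck_on_add Ck_on_sum Ck_on_mult Ck_on_diff Ck_on_const Ck_on_inner_left)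
    show "partial_deriv j (\<lambda>z. u z - q z) y = 0" if "j \<in> Basis" for j
      unfolding pr q1_def by (simp add: delta that)
    show "partial_deriv i (partial_deriv j (\<lambda>z. u z - q z)) y =
      - partial_deriv j (partial_deriv i (\<lambda>z. u z - q z)) y" if "i \<in> Basis" "j \<in> Basis" for i j
      using that by (simp add: pr2 q2)
  qed
qed

text \<open>In the sum-of-squares form at \<open>x\<close> only derivatives of the kind treated in
  \<open>partial_deriv2_compose_flat\<close> occur, and all of them vanish.\<close>

lemma diff_op_compose_flat:
  fixes g :: "real ^ 'n \<Rightarrow> real ^ 'n"
  assumes A: "\<And>i j. Ck_on 1 (\<lambda>x. A x $ i $ j) UNIV"
    and sym: "transpose (A x) = A x" and psd: "\<And>\<xi>. (A x *v \<xi>) \<bullet> \<xi> \<ge> 0"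
    and r: "Ck_on 2 r UNIV" and g: "\<And>j. j \<in> Basis \<Longrightarrow> Ck_on 2 (\<lambda>x. g x \<bullet> j) UNIV"
    and flat: "\<And>j. j \<in> Basis \<Longrightarrow> partial_deriv j r (g x) = 0"
    and antisym: "\<And>i j. i \<in> Basis \<Longrightarrow> j \<in> Basis \<Longrightarrow>
      partial_deriv i (partial_deriv j r) (g x) = - partial_deriv j (partial_deriv i r) (g x)"
  shows "diff_op A b (\<lambda>x. r (g x)) x = 0"
proof -
  obtain X :: "'n \<Rightarrow> real ^ 'n" and c where "\<forall>f. Ck_on 2 f UNIV \<longrightarrow>
      diff_op A b f x = (\<Sum>k\<in>UNIV. partial_deriv (X k) (partial_deriv (X k) f) x) + partial_deriv c f x"
    using diff_op_sum_of_squares[where b = b, OF A sym psd] by (elim exE)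
  then show ?thesis
    by (simp add: Ck_on_compose[OF r g] partial_deriv2_compose_flat[OF r g flat antisym])
qed

lemma diff_op_add:
  fixes f g :: "real ^ 'n \<Rightarrow> real"
  assumes A: "\<And>i j. Ck_on 1 (\<lambda>x. A x $ i $ j) UNIV"
    and f: "Ck_on 2 f UNIV" and g: "Ck_on 2 g UNIV"
  shows "diff_op A b (\<lambda>y. f y + g y) x = diff_op A b f x + diff_op A b g x"
proof -
  have 1: "partial_deriv v (\<lambda>y. f y + g y) = (\<lambda>y. partial_deriv v f y + partial_deriv v g y)" for v
    by (intro ext partial_deriv_eqI has_derivative_add has_derivative_partial_deriv
        Ck_on_differentiable[OF f] Ck_on_differentiable[OF g]) auto
  have 2: "partial_deriv w (\<lambda>y. partial_deriv v f y + partial_deriv v g y) x =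
      partial_deriv w (partial_deriv v f) x + partial_deriv w (partial_deriv v g) x" for v w
    by (intro partial_deriv_eqI has_derivative_add has_derivative_partial_deriv
        partial_deriv_differentiable[OF f] partial_deriv_differentiable[OF g])
  show ?thesis
    unfolding diff_op_nondivergence_form[OF A f] diff_op_nondivergence_form[OF A g]
      diff_op_nondivergence_form[OF A Ck_on_add[OF f g]] 1 2
    by (simp add: distrib_left sum.distrib)
qed

text \<open>The invariance hypothesis concerns smooth functions, whereas \<open>u\<close> is only
  \<open>C^2\<close>. With \<open>u = q + r\<close> for a Taylor polynomial \<open>q\<close> at
  \<alpha> \<circ> x, the hypothesis applies to \<open>q\<close>, and the flat remainder
  \<open>r\<close> contributes zero on both sides.\<close>

lemma left_translation_invariant_C2:
  fixes G :: "(real ^ 'n) monoid"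
  assumes A: "\<And>i j. Ck_on 1 (\<lambda>x. A x $ i $ j) UNIV"
    and sym: "\<And>x. transpose (A x) = A x" and psd: "\<And>x \<xi>. (A x *v \<xi>) \<bullet> \<xi> \<ge> 0"
    and inv: "left_translation_invariant G A b"
    and G: "\<And>\<alpha> j. j \<in> Basis \<Longrightarrow> Ck_on 2 (\<lambda>x. (\<alpha> \<otimes>\<^bsub>G\<^esub> x) \<bullet> j) UNIV"
    and u: "Ck_on 2 u UNIV"
  shows "diff_op A b (\<lambda>y. u (\<alpha> \<otimes>\<^bsub>G\<^esub> y)) x = diff_op A b u (\<alpha> \<otimes>\<^bsub>G\<^esub> x)"
proof -
  obtain q where q: "\<forall>k. Ck_on k q UNIV"
    and flat: "\<forall>j\<in>Basis. partial_deriv j (\<lambda>z. u z - q z) (\<alpha> \<otimes>\<^bsub>G\<^esub> x) = 0"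
    and antisym: "\<forall>i\<in>Basis. \<forall>j\<in>Basis.
      partial_deriv i (partial_deriv j (\<lambda>z. u z - q z)) (\<alpha> \<otimes>\<^bsub>G\<^esub> x) =
      - partial_deriv j (partial_deriv i (\<lambda>z. u z - q z)) (\<alpha> \<otimes>\<^bsub>G\<^esub> x)"
    using second_order_Taylor_polynomial[OF u, of "\<alpha> \<otimes>\<^bsub>G\<^esub> x"] by (elim exE conjE)
  define r where "r z = u z - q z" for z
  have r: "Ck_on 2 r UNIV" unfolding r_def[abs_def] by (rule Ck_on_diff[OF u q[rule_format]])
  have u_eq: "u = (\<lambda>z. q z + r z)" by (simp add: r_def fun_eq_iff)
  note q = q[rule_format] and flat = flat[folded r_def, rule_format]
    and antisym = antisym[folded r_def, rule_format]
  have "diff_op A b (\<lambda>y. r (\<alpha> \<otimes>\<^bsub>G\<^esub> y)) x = 0"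
    by (rule diff_op_compose_flat[where g = "\<lambda>y. \<alpha> \<otimes>\<^bsub>G\<^esub> y", OF A sym psd r G flat antisym])
  \<comment> \<open>The same lemma at the translated point, with the identity as inner map.\<close>
  moreover have "diff_op A b r (\<alpha> \<otimes>\<^bsub>G\<^esub> x) = 0"
    by (rule diff_op_compose_flat[where g = "\<lambda>y. y", OF A sym psd r Ck_on_inner_left flat antisym])
  moreover have "diff_op A b (\<lambda>y. q (\<alpha> \<otimes>\<^bsub>G\<^esub> y)) x = diff_op A b q (\<alpha> \<otimes>\<^bsub>G\<^esub> x)"
    using inv q by (auto simp: left_translation_invariant_def smooth_on_def)
  ultimately show ?thesis
    unfolding u_eq
    by (simp add: diff_op_add[OF A q r] diff_op_add[OF A Ck_on_compose[OF q G] Ck_on_compose[OF r G]])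
qed

section \<open>Difference quotients with positive weights\<close>

text \<open>The drift is sampled with step \<open>h^2\<close> so that it shares the denominator of
  the second differences; the whole is then a combination of increments \<open>f y - f x\<close>
  with positive weights \<open>1 / h^2\<close>.\<close>

definition diff_quotient ::
    "('n::finite \<Rightarrow> 'a::real_vector) \<Rightarrow> 'a \<Rightarrow> ('a \<Rightarrow> real) \<Rightarrow> 'a \<Rightarrow> real \<Rightarrow> real" where
  "diff_quotient X c f x h =
    ((\<Sum>k\<in>UNIV. f (x + h *\<^sub>R X k) + f (x - h *\<^sub>R X k) - 2 * f x) + (f (x + h\<^sup>2 *\<^sub>R c) - f x)) / h\<^sup>2"

lemma diff_quotient_mean_value:
  fixes f :: "'a::euclidean_space \<Rightarrow> real"
  assumes f: "Ck_on 2 f UNIV" and h: "0 < h"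
  shows "\<exists>s t. (\<forall>k. 0 < s k \<and> s k < h) \<and> 0 < t \<and> t < h\<^sup>2 \<and>
    diff_quotient X c f x h =
      (\<Sum>k\<in>UNIV. (partial_deriv (X k) (partial_deriv (X k) f) (x + s k *\<^sub>R X k) +
        partial_deriv (X k) (partial_deriv (X k) f) (x - s k *\<^sub>R X k)) / 2) +
      partial_deriv c f (x + t *\<^sub>R c)"
proof -
  have "\<forall>k. \<exists>s. 0 < s \<and> s < h \<and> f (x + h *\<^sub>R X k) + f (x - h *\<^sub>R X k) - 2 * f x =
      h\<^sup>2 / 2 * (partial_deriv (X k) (partial_deriv (X k) f) (x + s *\<^sub>R X k) +
        partial_deriv (X k) (partial_deriv (X k) f) (x - s *\<^sub>R X k))"
    by (intro allI, rule second_difference_mean_value[OF f h]) blast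
  then obtain s where s: "\<forall>k. 0 < s k \<and> s k < h \<and> f (x + h *\<^sub>R X k) + f (x - h *\<^sub>R X k) - 2 * f x =
      h\<^sup>2 / 2 * (partial_deriv (X k) (partial_deriv (X k) f) (x + s k *\<^sub>R X k) +
        partial_deriv (X k) (partial_deriv (X k) f) (x - s k *\<^sub>R X k))"
    unfolding choice_iff ..
  have f1: "Ck_on 1 f UNIV" by (rule Ck_on_mono[OF f]) simp
  have "0 < h\<^sup>2" using h by simp
  then obtain t where t: "0 < t" "t < h\<^sup>2"
    "f (x + h\<^sup>2 *\<^sub>R c) - f x = h\<^sup>2 * partial_deriv c f (x + t *\<^sub>R c)"
    by (rule first_difference_mean_value[OF f1])
  have "diff_quotient X c f x h =
      (\<Sum>k\<in>UNIV. (partial_deriv (X k) (partial_deriv (X k) f) (x + s k *\<^sub>R X k) +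
        partial_deriv (X k) (partial_deriv (X k) f) (x - s k *\<^sub>R X k)) / 2) +
      partial_deriv c f (x + t *\<^sub>R c)"
  proof -
    have q: "(f (x + h *\<^sub>R X k) + f (x - h *\<^sub>R X k) - 2 * f x) / h\<^sup>2 =
        (partial_deriv (X k) (partial_deriv (X k) f) (x + s k *\<^sub>R X k) +
        partial_deriv (X k) (partial_deriv (X k) f) (x - s k *\<^sub>R X k)) / 2" for k
    proof -
      have "f (x + h *\<^sub>R X k) + f (x - h *\<^sub>R X k) - 2 * f x =
        h\<^sup>2 / 2 * (partial_deriv (X k) (partial_deriv (X k) f) (x + s k *\<^sub>R X k) +
        partial_deriv (X k) (partial_deriv (X k) f) (x - s k *\<^sub>R X k))"
        using s by blast
      then show ?thesis using h by (simp only:) (simp add: field_simps)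
    qed
    show ?thesis
      unfolding diff_quotient_def t(3) add_divide_distrib[of "sum _ _"] sum_divide_distrib q
      using h by simp
  qed
  then show ?thesis using s t by blast
qed

text \<open>The intermediate points of the mean value formulas are squeezed to \<open>x\<close>, and
  the derivatives involved are continuous.\<close>

lemma diff_quotient_tendsto:
  fixes f :: "'a::euclidean_space \<Rightarrow> real"
  assumes f: "Ck_on 2 f UNIV" and h: "\<And>n. 0 < h n" "h \<longlonglongrightarrow> 0"
  shows "(\<lambda>n. diff_quotient X c f x (h n)) \<longlonglongrightarrow>
    (\<Sum>k\<in>UNIV. partial_deriv (X k) (partial_deriv (X k) f) x) + partial_deriv c f x"
proof -
  have "\<forall>n. \<exists>s t. (\<forall>k. 0 < s k \<and> s k < h n) \<and> 0 < t \<and> t < (h n)\<^sup>2 \<and>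
    diff_quotient X c f x (h n) =
      (\<Sum>k\<in>UNIV. (partial_deriv (X k) (partial_deriv (X k) f) (x + s k *\<^sub>R X k) +
        partial_deriv (X k) (partial_deriv (X k) f) (x - s k *\<^sub>R X k)) / 2) +
      partial_deriv c f (x + t *\<^sub>R c)"
    by (intro allI diff_quotient_mean_value[OF f h(1)])

  then obtain s t where s: "\<And>n k. 0 < s n k" "\<And>n k. s n k < h n"
    and t: "\<And>n. 0 < t n" "\<And>n. t n < (h n)\<^sup>2"
    and eq: "\<And>n. diff_quotient X c f x (h n) =
      (\<Sum>k\<in>UNIV. (partial_deriv (X k) (partial_deriv (X k) f) (x + s n k *\<^sub>R X k) +
        partial_deriv (X k) (partial_deriv (X k) f) (x - s n k *\<^sub>R X k)) / 2) +
      partial_deriv c f (x + t n *\<^sub>R c)"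
    unfolding choice_iff by blast
  have s0: "(\<lambda>n. s n k) \<longlonglongrightarrow> 0" for k
    by (rule tendsto_sandwich[OF _ _ tendsto_const h(2)])
      (use s in \<open>auto intro!: always_eventually less_imp_le\<close>)
  have "(\<lambda>n. (h n)\<^sup>2) \<longlonglongrightarrow> 0" using tendsto_power[OF h(2), of 2] by simp
  then have t0: "t \<longlonglongrightarrow> 0"
    by (rule tendsto_sandwich[OF _ _ tendsto_const, rotated 2])
      (use t in \<open>auto intro!: always_eventually less_imp_le\<close>)
  have cont: "(\<lambda>n. g (z n)) \<longlonglongrightarrow> g y" if "Ck_on l g UNIV" "z \<longlonglongrightarrow> y" for l and g :: "'a \<Rightarrow> real" and z y
    using Ck_on_continuous[OF that(1)] that(2)
    by (intro isCont_tendsto_compose[of y g]) (simp_all add: continuous_on_eq_continuous_at)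
  have lim: "(\<lambda>n. x + r n *\<^sub>R v) \<longlonglongrightarrow> x" "(\<lambda>n. x - r n *\<^sub>R v) \<longlonglongrightarrow> x"
    if "r \<longlonglongrightarrow> 0" for r and v :: 'a
  proof -
    have "(\<lambda>n. r n *\<^sub>R v) \<longlonglongrightarrow> 0" using tendsto_scaleR[OF that tendsto_const[of v]] by simp
    from tendsto_add[OF tendsto_const[of x] this] tendsto_diff[OF tendsto_const[of x] this]
    show "(\<lambda>n. x + r n *\<^sub>R v) \<longlonglongrightarrow> x" "(\<lambda>n. x - r n *\<^sub>R v) \<longlonglongrightarrow> x" by simp_all
  qed
  have C1: "Ck_on 1 (partial_deriv v f) UNIV" for v by (rule Ck_on_1_partial_deriv[OF f])
  have C0: "Ck_on 0 (partial_deriv v (partial_deriv v f)) UNIV" for v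
    by (rule Ck_on_partial_deriv) (simp only: One_nat_def[symmetric] C1)
  have "(\<lambda>n. (\<Sum>k\<in>UNIV. (partial_deriv (X k) (partial_deriv (X k) f) (x + s n k *\<^sub>R X k) +
        partial_deriv (X k) (partial_deriv (X k) f) (x - s n k *\<^sub>R X k)) / 2) +
      partial_deriv c f (x + t n *\<^sub>R c)) \<longlonglongrightarrow>
      (\<Sum>k\<in>UNIV. (partial_deriv (X k) (partial_deriv (X k) f) x +
        partial_deriv (X k) (partial_deriv (X k) f) x) / 2) + partial_deriv c f x"
    by (intro tendsto_add tendsto_sum tendsto_divide tendsto_const cont[OF C0] cont[OF C1]
        lim s0 t0) simp_all
  then show ?thesis unfolding eq by simp
qed

text \<open>Supplies the dominating bound for a limit under the integral over \<open>K\<close>. For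
  \<open>h \<le> 1\<close> the intermediate points stay in compact sets, products of
  \<open>K\<close> with balls around \<open>x\<close>, where the derivatives of \<Phi> are
  bounded.\<close>

lemma diff_quotient_bounded:
  fixes \<Phi> :: "'a::euclidean_space \<times> 'b::euclidean_space \<Rightarrow> real"
  assumes \<Phi>: "Ck_on 2 \<Phi> UNIV" and K: "compact K"
  shows "\<exists>M. \<forall>a\<in>K. \<forall>h. 0 < h \<and> h \<le> 1 \<longrightarrow> \<bar>diff_quotient X c (\<lambda>y. \<Phi> (a, y)) x h\<bar> \<le> M"
proof -
  have bdd: "\<exists>B. \<forall>a\<in>K. \<forall>t. \<bar>t\<bar> \<le> 1 \<longrightarrow> \<bar>g (a, x + t *\<^sub>R v)\<bar> \<le> B"
    if "Ck_on l g UNIV" for l and g :: "'a \<times> 'b \<Rightarrow> real" and v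
  proof -
    have "compact (g ` (K \<times> cball x (norm v)))"
      by (intro compact_continuous_image compact_Times K compact_cball
          continuous_on_subset[OF Ck_on_continuous[OF that]]) simp
    then obtain B where B: "\<forall>z\<in>g ` (K \<times> cball x (norm v)). norm z \<le> B"
      using compact_imp_bounded bounded_iff by blast
    have "\<bar>g (a, x + t *\<^sub>R v)\<bar> \<le> B" if "a \<in> K" "\<bar>t\<bar> \<le> 1" for a t
    proof -
      have "x + t *\<^sub>R v \<in> cball x (norm v)"
        using that by (simp add: dist_norm mult_left_le_one_le)
      then show ?thesis using B that by auto
    qed
    then show ?thesis by blast
  qed
  have C1: "Ck_on 1 (partial_deriv v \<Phi>) UNIV" for v by (rule Ck_on_1_partial_deriv[OF \<Phi>])
  have C0: "Ck_on 0 (partial_deriv v (partial_deriv v \<Phi>)) UNIV" for v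
    by (rule Ck_on_partial_deriv) (simp only: One_nat_def[symmetric] C1)
  let ?g2 = "\<lambda>k. partial_deriv (0, X k) (partial_deriv (0, X k) \<Phi>)"
  obtain B where B: "\<forall>k. \<forall>a\<in>K. \<forall>t. \<bar>t\<bar> \<le> 1 \<longrightarrow> \<bar>?g2 k (a, x + t *\<^sub>R X k)\<bar> \<le> B k"
    using choice[of "\<lambda>k B. \<forall>a\<in>K. \<forall>t. \<bar>t\<bar> \<le> 1 \<longrightarrow> \<bar>?g2 k (a, x + t *\<^sub>R X k)\<bar> \<le> B"] bdd[OF C0] by auto
  obtain B' where B': "\<forall>a\<in>K. \<forall>t. \<bar>t\<bar> \<le> 1 \<longrightarrow> \<bar>partial_deriv (0, c) \<Phi> (a, x + t *\<^sub>R c)\<bar> \<le> B'"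
    using bdd[OF C1] by blast
  have "\<bar>diff_quotient X c (\<lambda>y. \<Phi> (a, y)) x h\<bar> \<le> (\<Sum>k\<in>UNIV. B k) + B'"
    if a: "a \<in> K" and h: "0 < h" "h \<le> 1" for a h
  proof -
    have sl1: "partial_deriv v (\<lambda>y. \<Phi> (a, y)) y = partial_deriv (0, v) \<Phi> (a, y)" for v y
      by (rule partial_deriv_slice[OF Ck_on_differentiable[OF \<Phi>]]) simp
    obtain s t where st: "\<And>k. 0 < s k" "\<And>k. s k < h" "0 < t" "t < h\<^sup>2"
      and eq: "diff_quotient X c (\<lambda>y. \<Phi> (a, y)) x h =
      (\<Sum>k\<in>UNIV. (?g2 k (a, x + s k *\<^sub>R X k) + ?g2 k (a, x - s k *\<^sub>R X k)) / 2) +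
        partial_deriv (0, c) \<Phi> (a, x + t *\<^sub>R c)"
      using diff_quotient_mean_value[OF Ck_on_slice[OF \<Phi>, of a] h(1), of X c x]
      unfolding partial_deriv2_slice[OF \<Phi>] sl1 by blast
    have "\<bar>(?g2 k (a, x + s k *\<^sub>R X k) + ?g2 k (a, x - s k *\<^sub>R X k)) / 2\<bar> \<le> B k" for k
    proof -
      have *: "\<bar>s k\<bar> \<le> 1" using st(1,2)[of k] h by simp
      then have **: "\<bar>- s k\<bar> \<le> 1" by simp
      have "\<bar>?g2 k (a, x + s k *\<^sub>R X k)\<bar> \<le> B k" using B a * by blast
      moreover have "\<bar>?g2 k (a, x + (- s k) *\<^sub>R X k)\<bar> \<le> B k" using B a ** by blast
      ultimately show ?thesis by simp
    qed
    then have "\<bar>\<Sum>k\<in>UNIV. (?g2 k (a, x + s k *\<^sub>R X k) + ?g2 k (a, x - s k *\<^sub>R X k)) / 2\<bar> \<le> (\<Sum>k\<in>UNIV. B k)"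
      by (intro order_trans[OF sum_abs] sum_mono)
    moreover have "\<bar>t\<bar> \<le> 1" using st h power_le_one[of h 2] by simp
    then have "\<bar>partial_deriv (0, c) \<Phi> (a, x + t *\<^sub>R c)\<bar> \<le> B'" using B' a by blast
    ultimately show ?thesis unfolding eq by linarith
  qed
  then show ?thesis by blast
qed

text \<open>For fixed \<open>h\<close> the quotient is a finite linear combination of point values,
  hence commutes with the integral over the parameter.\<close>

lemma diff_quotient_integral:
  fixes F :: "'a::euclidean_space \<times> 'b::real_normed_vector \<Rightarrow> real"
  assumes F: "continuous_on UNIV F"
  shows "((\<lambda>a. diff_quotient X c (\<lambda>x. F (a, x)) x h) has_integral
    diff_quotient X c (\<lambda>x. integral (cbox l u) (\<lambda>a. F (a, x))) x h) (cbox l u)"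
proof -
  have "((\<lambda>a. F (a, y)) has_integral integral (cbox l u) (\<lambda>a. F (a, y))) (cbox l u)" for y
    by (intro integrable_integral integrable_continuous continuous_on_compose2[OF F]
        continuous_intros) auto
  then show ?thesis
    unfolding diff_quotient_def
    by (intro has_integral_divide has_integral_add has_integral_sum has_integral_diff
        has_integral_mult_right) simp_all
qed

section \<open>Maxima, convexity and positive weights\<close>

lemma diff_quotient_at_max_le_0:
  assumes "\<And>y. f y \<le> f x" and "0 < h"
  shows "diff_quotient X c f x h \<le> 0"
proof -
  have "f (x + h *\<^sub>R X k) + f (x - h *\<^sub>R X k) - 2 * f x \<le> 0" for k
    using assms(1)[of "x + h *\<^sub>R X k"] assms(1)[of "x - h *\<^sub>R X k"] by simp
  then show ?thesis
    unfolding diff_quotient_def using assms(1)[of "x + h\<^sup>2 *\<^sub>R c"]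
    by (intro divide_nonpos_nonneg add_nonpos_nonpos sum_nonpos) auto
qed

text \<open>Positive weights preserve an inequality between increments. It is meant for
  \<open>g\<close> a convex function of \<open>f\<close>, with \<open>d\<close> the slope of that
  convex function at \<open>f x\<close>.\<close>

lemma diff_quotient_tangent:
  assumes "\<And>y. d * (f y - f x) \<le> g y - g x"
  shows "d * diff_quotient X c f x h \<le> diff_quotient X c g x h"
proof -
  have "d * (f (x + h *\<^sub>R X k) + f (x - h *\<^sub>R X k) - 2 * f x) \<le>
      g (x + h *\<^sub>R X k) + g (x - h *\<^sub>R X k) - 2 * g x" for k
    using assms[of "x + h *\<^sub>R X k"] assms[of "x - h *\<^sub>R X k"] by (simp add: algebra_simps)
  then have "d * ((\<Sum>k\<in>UNIV. f (x + h *\<^sub>R X k) + f (x - h *\<^sub>R X k) - 2 * f x) + (f (x + h\<^sup>2 *\<^sub>R c) - f x))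
      \<le> (\<Sum>k\<in>UNIV. g (x + h *\<^sub>R X k) + g (x - h *\<^sub>R X k) - 2 * g x) + (g (x + h\<^sup>2 *\<^sub>R c) - g x)"
    unfolding distrib_left sum_distrib_left by (intro add_mono sum_mono assms)
  then show ?thesis
    unfolding diff_quotient_def times_divide_eq_right by (rule divide_right_mono) simp
qed

text \<open>Young's inequality for \<open>|s|^p\<close> and \<open>|t|\<close>, with conjugate
  exponents \<open>(p+1)/p\<close> and \<open>p+1\<close>, bounds the mixed term; the outcome is the
  tangent line inequality of the convex function \<open>|t|^(p+1)\<close> at
  \<open>s\<close>.\<close>

lemma abs_powr_tangent:
  fixes p s t :: real
  assumes p: "1 \<le> p"
  shows "(p + 1) * (\<bar>s\<bar> powr (p - 1) * s) * (t - s) \<le> \<bar>t\<bar> powr (p + 1) - \<bar>s\<bar> powr (p + 1)"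
proof (cases "s = 0")
  case False
  have 1: "\<bar>s\<bar> powr p = \<bar>s\<bar> powr (p - 1) * \<bar>s\<bar>" "\<bar>s\<bar> powr (p + 1) = \<bar>s\<bar> powr (p - 1) * s * s"
    using False powr_add[of "\<bar>s\<bar>" "p - 1" 1] powr_add[of "\<bar>s\<bar>" "p - 1" 2]
    by (simp_all add: power2_eq_square add.commute mult.assoc)
  have Y: "\<bar>s\<bar> powr p * \<bar>t\<bar> \<le> (\<bar>s\<bar> powr p) powr ((p + 1) / p) / ((p + 1) / p) + \<bar>t\<bar> powr (p + 1) / (p + 1)"
    using p by (intro Youngs_inequality) (auto simp: field_simps)
  have "(p + 1) * (\<bar>s\<bar> powr p * \<bar>t\<bar>) \<le> p * \<bar>s\<bar> powr (p + 1) + \<bar>t\<bar> powr (p + 1)"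
  proof -
    have "(\<bar>s\<bar> powr p) powr ((p + 1) / p) = \<bar>s\<bar> powr (p + 1)"
      using p by (simp add: powr_powr)
    then have "\<bar>s\<bar> powr p * \<bar>t\<bar> \<le> (p * \<bar>s\<bar> powr (p + 1) + \<bar>t\<bar> powr (p + 1)) / (p + 1)"
      using Y unfolding divide_divide_eq_right by (simp add: add_divide_distrib mult.commute)
    then show ?thesis using p by (simp add: pos_le_divide_eq mult.commute)
  qed
  moreover have "\<bar>s\<bar> powr (p - 1) * (s * t) \<le> \<bar>s\<bar> powr (p - 1) * (\<bar>s\<bar> * \<bar>t\<bar>)"
    by (intro mult_left_mono) (auto simp: abs_mult[symmetric])
  then have "(p + 1) * (\<bar>s\<bar> powr (p - 1) * (s * t)) \<le> (p + 1) * (\<bar>s\<bar> powr p * \<bar>t\<bar>)"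
    using p by (simp add: 1 mult.assoc)
  moreover have "(p + 1) * (\<bar>s\<bar> powr (p - 1) * s) * (t - s) =
      (p + 1) * (\<bar>s\<bar> powr (p - 1) * (s * t)) - (p + 1) * \<bar>s\<bar> powr (p + 1)"
    unfolding 1(2) by (simp add: algebra_simps)
  ultimately show ?thesis by (simp add: distrib_right)
qed simp

section \<open>Averages over right translates\<close>

text \<open>Invariance is stated for images, whereas \<open>distr\<close> needs preimages: the
  preimage under translation by \<open>x\<close> is the image under translation by its
  inverse.\<close>

lemma distr_right_translation:
  assumes G: "group G" and c: "carrier G = space M" and inv: "right_invariant_measure G M"
    and x: "x \<in> carrier G"
  shows "(\<lambda>y. y \<otimes>\<^bsub>G\<^esub> x) \<in> M \<rightarrow>\<^sub>M M" and "distr M M (\<lambda>y. y \<otimes>\<^bsub>G\<^esub> x) = M"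
proof -
  interpret group G by (rule G)
  let ?T = "\<lambda>y. y \<otimes>\<^bsub>G\<^esub> x"
  have vimage: "?T -` E \<inter> space M = (\<lambda>y. y \<otimes>\<^bsub>G\<^esub> inv\<^bsub>G\<^esub> x) ` E" if "E \<in> sets M" for E
  proof -
    have E: "E \<subseteq> carrier G" using sets.sets_into_space[OF that] c by simp
    show ?thesis
    proof (intro equalityI subsetI)
      fix y assume "y \<in> ?T -` E \<inter> space M"
      then have "y = (y \<otimes>\<^bsub>G\<^esub> x) \<otimes>\<^bsub>G\<^esub> inv\<^bsub>G\<^esub> x" "y \<otimes>\<^bsub>G\<^esub> x \<in> E"
        using x by (auto simp: c[symmetric] m_assoc)
      then show "y \<in> (\<lambda>y. y \<otimes>\<^bsub>G\<^esub> inv\<^bsub>G\<^esub> x) ` E" by (rule image_eqI)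
    next
      fix y assume "y \<in> (\<lambda>y. y \<otimes>\<^bsub>G\<^esub> inv\<^bsub>G\<^esub> x) ` E"
      then show "y \<in> ?T -` E \<inter> space M"
        using x E by (auto simp: c[symmetric] m_assoc subset_iff)
    qed
  qed
  have T: "?T -` E \<inter> space M \<in> sets M" "emeasure M (?T -` E \<inter> space M) = emeasure M E"
    if "E \<in> sets M" for E
    using inv that inv_closed[OF x] unfolding vimage[OF that] right_invariant_measure_def by auto
  show meas: "?T \<in> M \<rightarrow>\<^sub>M M"
    by (rule measurableI) (use x T(1) in \<open>auto simp: c[symmetric]\<close>)
  show "distr M M ?T = M"
    by (rule measure_eqI) (simp_all add: emeasure_distr[OF meas] T)
qed

lemma integral_right_translation:
  fixes f :: "'a \<Rightarrow> real"
  assumes "group G" "carrier G = space M" "right_invariant_measure G M"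
    and x: "x \<in> carrier G" and f: "integrable M f"
  shows "integrable M (\<lambda>y. f (y \<otimes>\<^bsub>G\<^esub> x))"
    and "integral\<^sup>L M (\<lambda>y. f (y \<otimes>\<^bsub>G\<^esub> x)) = integral\<^sup>L M f"
proof -
  note T = distr_right_translation[OF assms(1-4)]
  have f': "f \<in> borel_measurable M" using f by simp
  show "integrable M (\<lambda>y. f (y \<otimes>\<^bsub>G\<^esub> x))"
    using integrable_distr_eq[OF T(1) f'] f by (simp add: T(2))
  show "integral\<^sup>L M (\<lambda>y. f (y \<otimes>\<^bsub>G\<^esub> x)) = integral\<^sup>L M f"
    using integral_distr[OF T(1) f'] by (simp add: T(2))
qed

text \<open>Dominated convergence: the complements of the balls of radius \<open>n\<close> shrink to
  the empty set.\<close>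

lemma integral_outside_ball_small:
  fixes f :: "'a::euclidean_space \<Rightarrow> real"
  assumes f: "integrable lebesgue f" and e: "0 < e"
  shows "\<exists>R. integral\<^sup>L lebesgue (\<lambda>x. indicator (- cball 0 R) x * f x) < e"
proof -
  have "(\<lambda>n. integral\<^sup>L lebesgue (\<lambda>x. indicator (- cball 0 (real n)) x * f x)) \<longlonglongrightarrow>
      integral\<^sup>L lebesgue (\<lambda>x::'a. 0::real)"
  proof (rule integral_dominated_convergence[where w = "\<lambda>x. norm (f x)"])
    show "AE x in lebesgue. (\<lambda>n. indicator (- cball 0 (real n)) x * f x) \<longlonglongrightarrow> 0"
    proof (rule AE_I2)
      fix x :: 'a
      have "eventually (\<lambda>n. indicator (- cball 0 (real n)) x * f x = 0) sequentially"
        using eventually_ge_at_top[of "nat \<lceil>norm x\<rceil>"]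
        by eventually_elim (auto simp: indicator_def)
      then show "(\<lambda>n. indicator (- cball 0 (real n)) x * f x) \<longlonglongrightarrow> 0"
        by (rule tendsto_eventually)
    qed
    show "AE x in lebesgue. norm (indicator (- cball 0 (real n)) x * f x) \<le> norm (f x)" for n
      by (rule AE_I2) (simp add: indicator_def)
    show "(\<lambda>x. indicator (- cball 0 (real n)) x * f x) \<in> borel_measurable lebesgue" for n
      using f by (intro borel_measurable_times borel_measurable_indicator) auto
  qed (use f in auto)
  then have "eventually (\<lambda>n. integral\<^sup>L lebesgue (\<lambda>x. indicator (- cball 0 (real n)) x * f x) < e) sequentially"
    using e by (intro order_tendstoD) simp_all
  then show ?thesis using eventually_happens[of _ sequentially] by fastforce
qed

text \<open>If the translate of the box by \<open>x\<close> misses a large ball, the average is at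
  most the tail of the integral of \<open>f\<close>, because right translation preserves the
  measure. The translate can meet the ball only for \<open>x\<close> in a compact set.\<close>

lemma average_vanishes_at_infinity:
  fixes G :: "(real ^ 'n) monoid" and f :: "real ^ 'n \<Rightarrow> real"
  assumes G: "lie_group G" and inv: "right_invariant_measure G lebesgue"
    and f: "integrable lebesgue f" "continuous_on UNIV f" "\<And>x. 0 \<le> f x" and e: "0 < e"
  shows "\<exists>D. compact D \<and> (\<forall>x. x \<notin> D \<longrightarrow> integral (cbox l u) (\<lambda>\<alpha>. f (\<alpha> \<otimes>\<^bsub>G\<^esub> x)) < e)"
proof -
  have gr: "group G" and c: "carrier G = UNIV" using G by (auto simp: lie_group_def)
  interpret group G by (rule gr)
  have "Ck_on 0 (\<lambda>(x, y). x \<otimes>\<^bsub>G\<^esub> y) UNIV" "Ck_on 0 (\<lambda>x. inv\<^bsub>G\<^esub> x) UNIV"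
    using G unfolding lie_group_def smooth_on_def by blast+
  then have mult: "continuous_on UNIV (\<lambda>z. fst z \<otimes>\<^bsub>G\<^esub> snd z)" and inv': "continuous_on UNIV (\<lambda>x. inv\<^bsub>G\<^esub> x)"
    by (simp_all add: case_prod_unfold)
  obtain R where R: "integral\<^sup>L lebesgue (\<lambda>x. indicator (- cball 0 R) x * f x) < e"
    using integral_outside_ball_small[OF f(1) e] by blast
  let ?K = "cbox l u"
  \<comment> \<open>The points \<open>x\<close> whose translate of the box meets the ball: inverses
    of box elements times ball elements, a continuous image of a compact product.\<close>
  let ?D = "(\<lambda>z. inv\<^bsub>G\<^esub> (fst z) \<otimes>\<^bsub>G\<^esub> snd z) ` (?K \<times> cball 0 R)"
  have "continuous_on (?K \<times> cball 0 R) (\<lambda>z. (inv\<^bsub>G\<^esub> (fst z), snd z))"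
    by (intro continuous_intros continuous_on_compose2[OF inv']) auto
  then have "continuous_on (?K \<times> cball 0 R) (\<lambda>z. inv\<^bsub>G\<^esub> (fst z) \<otimes>\<^bsub>G\<^esub> snd z)"
    using continuous_on_compose2[OF mult] by fastforce
  then have "compact ?D" by (intro compact_continuous_image compact_Times compact_cbox compact_cball)
  moreover have "integral ?K (\<lambda>\<alpha>. f (\<alpha> \<otimes>\<^bsub>G\<^esub> x)) < e" if x: "x \<notin> ?D" for x
  proof -
    have out: "\<alpha> \<otimes>\<^bsub>G\<^esub> x \<notin> cball 0 R" if "\<alpha> \<in> ?K" for \<alpha>
    proof
      assume "\<alpha> \<otimes>\<^bsub>G\<^esub> x \<in> cball 0 R"
      then have "x \<in> ?D"
        using that by (intro image_eqI[where x = "(\<alpha>, \<alpha> \<otimes>\<^bsub>G\<^esub> x)"])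
          (simp_all add: m_assoc[symmetric] c)
      then show False using x by contradiction
    qed
    have "continuous_on ?K (\<lambda>\<alpha>. f (\<alpha> \<otimes>\<^bsub>G\<^esub> x))"
    proof (rule continuous_on_compose2[OF f(2)])
      have "continuous_on ?K (\<lambda>\<alpha>. (\<alpha>, x))" by (intro continuous_intros)
      then show "continuous_on ?K (\<lambda>\<alpha>. \<alpha> \<otimes>\<^bsub>G\<^esub> x)"
        using continuous_on_compose2[OF mult] by fastforce
    qed simp
    then have ai: "(\<lambda>\<alpha>. f (\<alpha> \<otimes>\<^bsub>G\<^esub> x)) absolutely_integrable_on ?K"
      by (rule absolutely_integrable_continuous)
    have g: "integrable lebesgue (\<lambda>x. indicator (- cball 0 R) x * f x)"
      using integrable_mult_indicator[OF _ f(1), of "- cball 0 R"] by simp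
    have "integral ?K (\<lambda>\<alpha>. f (\<alpha> \<otimes>\<^bsub>G\<^esub> x)) = integral\<^sup>L lebesgue (\<lambda>\<alpha>. indicator ?K \<alpha> *\<^sub>R f (\<alpha> \<otimes>\<^bsub>G\<^esub> x))"
      using set_lebesgue_integral_eq_integral(2)[OF ai] by (simp add: set_lebesgue_integral_def)
    \<comment> \<open>By \<open>out\<close>, the indicator of the box lies below the pulled-back
      indicator of the complement of the ball; after that, invariance removes the
      translation.\<close>
    also have "\<dots> \<le> integral\<^sup>L lebesgue
        (\<lambda>\<alpha>. indicator (- cball 0 R) (\<alpha> \<otimes>\<^bsub>G\<^esub> x) * f (\<alpha> \<otimes>\<^bsub>G\<^esub> x))"
    proof (rule integral_mono)
      show "integrable lebesgue (\<lambda>\<alpha>. indicator ?K \<alpha> *\<^sub>R f (\<alpha> \<otimes>\<^bsub>G\<^esub> x))"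
        using ai by (simp add: set_integrable_def)
      show "integrable lebesgue (\<lambda>\<alpha>. indicator (- cball 0 R) (\<alpha> \<otimes>\<^bsub>G\<^esub> x) * f (\<alpha> \<otimes>\<^bsub>G\<^esub> x))"
        by (rule integral_right_translation(1)[OF gr _ inv _ g]) (simp_all add: c)
      show "indicator ?K \<alpha> *\<^sub>R f (\<alpha> \<otimes>\<^bsub>G\<^esub> x) \<le> indicator (- cball 0 R) (\<alpha> \<otimes>\<^bsub>G\<^esub> x) * f (\<alpha> \<otimes>\<^bsub>G\<^esub> x)" for \<alpha>
        using out[of \<alpha>] f(3)[of "\<alpha> \<otimes>\<^bsub>G\<^esub> x"] by (auto simp: indicator_def)
    qed
    also have "\<dots> = integral\<^sup>L lebesgue (\<lambda>x. indicator (- cball 0 R) x * f x)"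
      by (rule integral_right_translation(2)[OF gr _ inv _ g]) (simp_all add: c)
    finally show ?thesis using R by simp
  qed
  ultimately show ?thesis by blast
qed

section \<open>The Liouville theorem\<close>

theorem corollary1p7:
  fixes A :: "real ^ 'n \<Rightarrow> real ^ 'n ^ 'n"
    and b :: "real ^ 'n \<Rightarrow> real ^ 'n"
    and G :: "(real ^ 'n) monoid"
    and p :: real
    and u :: "real ^ 'n \<Rightarrow> real"
  assumes smooth_A: "\<And>i j. smooth_on (\<lambda>x. A x $ i $ j) UNIV"
    and smooth_b: "\<And>j. smooth_on (\<lambda>x. b x $ j) UNIV"
    and symmetric_A: "\<And>x. transpose (A x) = A x"
    and nonneg_A: "\<And>x \<xi>. (A x *v \<xi>) \<bullet> \<xi> \<ge> 0"
    and trace_A: "trace (A 0) > 0"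
    and hypoelliptic: "hypoelliptic A b"
    and lie_group: "lie_group G"
    and invariant: "left_translation_invariant G A b"
    and left_haar: "left_invariant_measure G lebesgue"
    and right_haar: "right_invariant_measure G lebesgue"
    and p: "1 \<le> p"
    and u_C2: "Ck_on 2 u UNIV"
    and u_Lp: "u \<in> Lq_space (p + 1) lebesgue"
    and solution: "\<And>x. diff_op A b u x = \<bar>u x\<bar> powr (p - 1) * u x"
  shows "\<forall>x. u x = 0"
proof (rule ccontr)
  assume "\<not> (\<forall>x. u x = 0)"
  then obtain y where y: "u y \<noteq> 0" by blast
  have gr: "group G" and c: "carrier G = UNIV"
    and mult: "Ck_on k (\<lambda>(x, y). x \<otimes>\<^bsub>G\<^esub> y) UNIV" for k
    using lie_group by (auto simp: lie_group_def smooth_on_def)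
  interpret group G by (rule gr)
  have A1: "Ck_on 1 (\<lambda>x. A x $ i $ j) UNIV" for i j
    using smooth_A by (simp only: smooth_on_def)

  \<comment> \<open>Regularity of the translated solution\<close>
  let ?K = "cbox 0 One :: (real ^ 'n) set"
  define \<Phi> where "\<Phi> z = u (fst z \<otimes>\<^bsub>G\<^esub> snd z)" for z
  have mult_j: "Ck_on k (\<lambda>z. (fst z \<otimes>\<^bsub>G\<^esub> snd z) \<bullet> j) UNIV" for k j
    using Ck_on_bounded_linear[OF bounded_linear_inner_left mult, of k j]
    by (simp add: case_prod_unfold)
  have \<Phi>: "Ck_on 2 \<Phi> UNIV"
    unfolding \<Phi>_def[abs_def] by (rule Ck_on_compose[OF u_C2 mult_j])
  have mult_slice: "Ck_on 2 (\<lambda>x. (\<alpha> \<otimes>\<^bsub>G\<^esub> x) \<bullet> j) UNIV" for \<alpha> j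
    using Ck_on_slice[OF mult_j[of 2 j], of \<alpha>] by simp

  \<comment> \<open>The averaged power of the solution\<close>
  define V where "V s = \<bar>s\<bar> powr (p + 1)" for s
  have V: "continuous_on UNIV V"
    unfolding V_def[abs_def] using p by (intro continuous_on_powr' continuous_intros) auto
  have V_pos: "0 \<le> V s" for s by (simp add: V_def)
  have V\<Phi>: "continuous_on UNIV (\<lambda>z. V (\<Phi> z))"
    by (rule continuous_on_compose2[OF V Ck_on_continuous[OF \<Phi>]]) simp
  define w where "w x = integral ?K (\<lambda>\<alpha>. V (\<Phi> (\<alpha>, x)))" for x
  have slice: "continuous_on S (\<lambda>\<alpha>. f (\<alpha>, x))" if "continuous_on UNIV f"
    for S and f :: "(real ^ 'n) \<times> (real ^ 'n) \<Rightarrow> real" and x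
    by (rule continuous_on_compose2[OF that]) (auto intro: continuous_intros)
  \<comment> \<open>A continuous nonnegative function with zero integral over a box with nonempty
    interior vanishes on the box.\<close>
  have w_0: "V (\<Phi> (\<alpha>, x)) = 0" if "w x = 0" "\<alpha> \<in> ?K" for x \<alpha>
    using integral_cbox_eq_0_iff[of 0 One "\<lambda>\<alpha>. V (\<Phi> (\<alpha>, x))"] slice[OF V\<Phi>] that V_pos
    by (simp add: w_def box_ne_empty)
  have w_nonneg: "0 \<le> w x" for x
    unfolding w_def by (rule integral_nonneg) (auto simp: V_pos intro: integrable_continuous slice[OF V\<Phi>])

  obtain x1 where x1: "0 < w x1"
  proof
    \<comment> \<open>The corner \<open>0\<close> of the cube, which need not be the neutral
      element, translates this point to \<open>y\<close>, where \<open>u\<close> does not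
      vanish.\<close>
    let ?x = "inv\<^bsub>G\<^esub> 0 \<otimes>\<^bsub>G\<^esub> y"
    have "0 \<otimes>\<^bsub>G\<^esub> ?x = y" by (simp add: m_assoc[symmetric] c)
    then have "V (\<Phi> (0, ?x)) \<noteq> 0" using y by (simp add: \<Phi>_def V_def)
    then have "w ?x \<noteq> 0" using w_0[of ?x 0] by (auto simp: mem_box)
    then show "0 < w ?x" using w_nonneg[of ?x] by simp
  qed

  \<comment> \<open>A positive global maximum of the average\<close>
  have "integrable lebesgue (\<lambda>x. V (u x))"
    using u_Lp by (simp add: Lq_space_def V_def)
  moreover have "continuous_on UNIV (\<lambda>x. V (u x))"
    by (rule continuous_on_compose2[OF V Ck_on_continuous[OF u_C2]]) simp
  \<comment> \<open>With the threshold \<open>w x1\<close>, the average stays below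
    \<open>w x1\<close> off the compact set \<open>D\<close>; hence \<open>x1\<close> lies in
    \<open>D\<close> and a maximum over \<open>D\<close> is global.\<close>
  ultimately obtain D where D: "compact D" "\<And>x. x \<notin> D \<Longrightarrow> w x < w x1"
    using average_vanishes_at_infinity[OF lie_group right_haar _ _ V_pos x1, of u 0 One]
    by (auto simp: w_def \<Phi>_def)
  have "continuous_on (UNIV \<times> ?K) (\<lambda>(x, \<alpha>). V (\<Phi> (\<alpha>, x)))"
    unfolding case_prod_unfold
    by (rule continuous_on_compose2[OF V\<Phi>]) (auto intro!: continuous_intros)
  then have "continuous_on UNIV w"
    unfolding w_def[abs_def] by (rule integral_continuous_on_param)
  moreover have "x1 \<in> D" using D(2)[of x1] by auto
  ultimately obtain x0 where x0: "x0 \<in> D" "\<And>x. x \<in> D \<Longrightarrow> w x \<le> w x0"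
    using continuous_attains_sup[OF D(1), of w] continuous_on_subset by blast
  have max: "w x \<le> w x0" for x
    using x0(2)[of x] x0(2)[OF \<open>x1 \<in> D\<close>] D(2)[of x] by linarith

  \<comment> \<open>The equation at the maximum point\<close>
  obtain X :: "'n \<Rightarrow> real ^ 'n" and d where X: "\<forall>f. Ck_on 2 f UNIV \<longrightarrow>
      diff_op A b f x0 = (\<Sum>k\<in>UNIV. partial_deriv (X k) (partial_deriv (X k) f) x0) + partial_deriv d f x0"
    using diff_op_sum_of_squares[where b = b and x = x0, OF A1 symmetric_A nonneg_A] by (elim exE)
  \<comment> \<open>\<open>L\<close> is the right-hand side of the equation at \<alpha> \<circ> x0,
    and \<open>p + 1\<close> times it is the slope of \<open>V\<close> at
    \<open>\<Phi> (\<alpha>, x0)\<close>; this coincidence turns the limit integrand into a multiple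
    of a square.\<close>
  define L where "L \<alpha> = \<bar>\<Phi> (\<alpha>, x0)\<bar> powr (p - 1) * \<Phi> (\<alpha>, x0)" for \<alpha>
  have L_eq: "L \<alpha> = (\<Sum>k\<in>UNIV. partial_deriv (X k) (partial_deriv (X k) (\<lambda>x. \<Phi> (\<alpha>, x))) x0) +
      partial_deriv d (\<lambda>x. \<Phi> (\<alpha>, x)) x0" for \<alpha>
  proof -
    have "L \<alpha> = diff_op A b u (\<alpha> \<otimes>\<^bsub>G\<^esub> x0)" by (simp add: solution L_def \<Phi>_def)
    also have "\<dots> = diff_op A b (\<lambda>x. \<Phi> (\<alpha>, x)) x0"
      using left_translation_invariant_C2[OF A1 symmetric_A nonneg_A invariant mult_slice u_C2]
      by (simp add: \<Phi>_def)
    finally show ?thesis using X Ck_on_slice[OF \<Phi>, of \<alpha>] by simp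
  qed
  \<comment> \<open>Continuity is read off from the derivative formula: for \<open>p = 1\<close> the
    factor \<open>|\<Phi>| powr (p - 1)\<close> may jump at zeros of \<Phi>, since
    \<open>0 powr 0 = 0\<close>.\<close>
  have L_cont: "continuous_on ?K L"
  proof -
    have 1: "partial_deriv d (\<lambda>x. \<Phi> (\<alpha>, x)) x0 = partial_deriv (0, d) \<Phi> (\<alpha>, x0)" for \<alpha>
      by (rule partial_deriv_slice[OF Ck_on_differentiable[OF \<Phi>]]) simp
    have C1: "Ck_on 1 (partial_deriv v \<Phi>) UNIV" for v by (rule Ck_on_1_partial_deriv[OF \<Phi>])
    have C0: "Ck_on 0 (partial_deriv v (partial_deriv v \<Phi>)) UNIV" for v
      by (rule Ck_on_partial_deriv) (simp only: One_nat_def[symmetric] C1)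
    show ?thesis
      unfolding L_eq[abs_def] 1 partial_deriv2_slice[OF \<Phi>]
      by (intro continuous_on_add continuous_on_sum slice Ck_on_continuous[OF C1] Ck_on_continuous[OF C0])
  qed

  \<comment> \<open>Difference quotients along a null sequence\<close>
  define h where "h n = inverse (real (Suc n))" for n
  have h: "0 < h n" "h n \<le> 1" "h \<longlonglongrightarrow> 0" for n
    using LIMSEQ_inverse_real_of_nat by (auto simp: h_def[abs_def] inverse_le_1_iff)
  define Q where "Q n \<alpha> = diff_quotient X d (\<lambda>x. \<Phi> (\<alpha>, x)) x0 (h n)" for n \<alpha>
  have Q_cont: "continuous_on ?K (Q n)" for n
    unfolding Q_def[abs_def] diff_quotient_def using h(1)[of n]
    by (intro continuous_intros slice Ck_on_continuous[OF \<Phi>]) auto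
  \<comment> \<open>Convexity bounds the integrand by the quotient of \<open>V\<close> composed with
    \<Phi>; the integral of the latter is the quotient of \<open>w\<close>, which is nonpositive at
    the maximum.\<close>
  have le: "integral ?K (\<lambda>\<alpha>. (p + 1) * L \<alpha> * Q n \<alpha>) \<le> 0" for n
  proof -
    have "integral ?K (\<lambda>\<alpha>. (p + 1) * L \<alpha> * Q n \<alpha>) \<le> diff_quotient X d w x0 (h n)"
    proof (rule has_integral_le)
      show "((\<lambda>\<alpha>. (p + 1) * L \<alpha> * Q n \<alpha>) has_integral integral ?K (\<lambda>\<alpha>. (p + 1) * L \<alpha> * Q n \<alpha>)) ?K"
        by (intro integrable_integral integrable_continuous continuous_intros L_cont Q_cont)
      show "((\<lambda>\<alpha>. diff_quotient X d (\<lambda>x. V (\<Phi> (\<alpha>, x))) x0 (h n)) has_integral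
          diff_quotient X d w x0 (h n)) ?K"
        unfolding w_def[abs_def] by (rule diff_quotient_integral[OF V\<Phi>])
      show "(p + 1) * L \<alpha> * Q n \<alpha> \<le> diff_quotient X d (\<lambda>x. V (\<Phi> (\<alpha>, x))) x0 (h n)" for \<alpha>
        unfolding Q_def L_def V_def by (rule diff_quotient_tangent[OF abs_powr_tangent[OF p]])
    qed
    also have "\<dots> \<le> 0" by (rule diff_quotient_at_max_le_0[of w, OF max h(1)])
    finally show ?thesis .
  qed

  \<comment> \<open>Passage to the limit\<close>
  obtain M where M: "\<forall>\<alpha>\<in>?K. \<forall>h. 0 < h \<and> h \<le> 1 \<longrightarrow> \<bar>diff_quotient X d (\<lambda>x. \<Phi> (\<alpha>, x)) x0 h\<bar> \<le> M"
    using diff_quotient_bounded[OF \<Phi> compact_cbox] by blast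
  \<comment> \<open>Pointwise, \<open>Q n\<close> tends to the second-order expression in
    \<open>L_eq\<close>, that is, to \<open>L\<close>.\<close>
  have "(\<lambda>n. integral ?K (\<lambda>\<alpha>. (p + 1) * L \<alpha> * Q n \<alpha>)) \<longlonglongrightarrow> integral ?K (\<lambda>\<alpha>. (p + 1) * L \<alpha> * L \<alpha>)"
  proof (rule dominated_convergence(2)[where h = "\<lambda>\<alpha>. \<bar>(p + 1) * L \<alpha>\<bar> * M"])
    show "(\<lambda>\<alpha>. (p + 1) * L \<alpha> * Q n \<alpha>) integrable_on ?K" for n
      by (intro integrable_continuous continuous_intros L_cont Q_cont)
    show "(\<lambda>\<alpha>. \<bar>(p + 1) * L \<alpha>\<bar> * M) integrable_on ?K"
      by (intro integrable_continuous continuous_intros L_cont)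
    show "norm ((p + 1) * L \<alpha> * Q n \<alpha>) \<le> \<bar>(p + 1) * L \<alpha>\<bar> * M" if "\<alpha> \<in> ?K" for n \<alpha>
      unfolding real_norm_def abs_mult[of _ "Q n \<alpha>"]
      by (rule mult_left_mono) (use M that h in \<open>auto simp: Q_def\<close>)
    show "(\<lambda>n. (p + 1) * L \<alpha> * Q n \<alpha>) \<longlonglongrightarrow> (p + 1) * L \<alpha> * L \<alpha>" for \<alpha>
      unfolding Q_def L_eq
      by (intro tendsto_mult_left diff_quotient_tendsto Ck_on_slice[OF \<Phi>] h)
  qed
  then have "integral ?K (\<lambda>\<alpha>. (p + 1) * L \<alpha> * L \<alpha>) \<le> 0"
    by (rule LIMSEQ_le_const2) (use le in blast)
  moreover have pos: "0 \<le> (p + 1) * L \<alpha> * L \<alpha>" for \<alpha>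
    using p by (simp add: mult.assoc)
  moreover have cont: "continuous_on ?K (\<lambda>\<alpha>. (p + 1) * L \<alpha> * L \<alpha>)"
    by (intro continuous_intros L_cont)
  ultimately have "integral ?K (\<lambda>\<alpha>. (p + 1) * L \<alpha> * L \<alpha>) = 0"
    by (intro antisym integral_nonneg integrable_continuous) auto
  then have "(p + 1) * L \<alpha> * L \<alpha> = 0" if "\<alpha> \<in> ?K" for \<alpha>
    using integral_cbox_eq_0_iff[OF cont _ pos] that by (auto simp: box_ne_empty)
  \<comment> \<open>\<open>L\<close> vanishes only where \<Phi> does, so \<open>w x0 = 0\<close>,
    against \<open>0 < w x1 \<le> w x0\<close>.\<close>
  then have "V (\<Phi> (\<alpha>, x0)) = 0" if "\<alpha> \<in> ?K" for \<alpha>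
    using that p by (auto simp: L_def V_def)
  then have "w x0 = integral ?K (\<lambda>_. 0)"
    unfolding w_def by (intro integral_cong) auto
  then show False using x1 max[of x1] by simp
qed

end
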